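(* Let $A$ be a $C^*$-algebra with a strictly positive element (in particular, $A$ may be any separable $C^*$-algebra), regarded as a right Hilbert module over itself. Then the following are equivalent: $A$ has the property (mBS2); $A$ is unital; $A$ has the module Schur property.
   Context: A $C^*$-algebra $A$ is a right Hilbert $A$-module over itself with inner product $\langle a,b\rangle=a^*b$. For a Hilbert $A$-module $V$, the topology $\tau_{\widehat V}$ on $V$ is the locally convex topology generated by the seminorms $x\mapsto\|\langle z,x\rangle\|$, $z\in V$. A sequence $\{x_n\}$ in $V$ is called $\tau_{\widehat V}$-convergent if for every $z\in V$ the sequence $\{\langle z,x_n\rangle\}$ converges in norm in $A$ (so the limit may lie in the completion of $V$ with respect to $\tau_{\widehat V}$, not necessarily in $V$). $V$ has the module Schur property if every $\tau_{\widehat V}$-convergent sequence in $V$ converges in norm (to an element of $V$). $V$ has the property (mBS2) if every $\tau_{\widehat V}$-convergent sequence $\{x_n\}$ in $V$ admits a subsequence $\{x_{n(i)}\}$ such that the sequence $\frac1k\sum_{i=1}^k x_{n(i)}$, $k\in\mathbb N$, converges in norm (to an element of $V$). *)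

theory Defs
  imports "HOL-Analysis.Analysis"
begin

section \<open>C*-algebras\<close>

text \<open>
  The distribution has no complex vector spaces as a type class. Complex scalars are therefore
  added here on top of the existing real scaling, in the style of \<^class>\<open>real_vector\<close>.
\<close>

class complex_vector = real_vector +
  fixes scaleC :: "complex \<Rightarrow> 'a \<Rightarrow> 'a"  (infixr \<open>*\<^sub>C\<close> 75)
  assumes scaleC_add_right: "c *\<^sub>C (x + y) = c *\<^sub>C x + c *\<^sub>C y"
    and scaleC_add_left: "(c + d) *\<^sub>C x = c *\<^sub>C x + d *\<^sub>C x"
    and scaleC_scaleC: "c *\<^sub>C d *\<^sub>C x = (c * d) *\<^sub>C x"
    and scaleR_scaleC: "r *\<^sub>R x = complex_of_real r *\<^sub>C x"

text \<open>
  Complex C*-algebras. No unit is assumed: \<^class>\<open>real_normed_algebra\<close> (an associative algebra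
  with submultiplicative norm) does not require one. The zero algebra is allowed.
\<close>

class cstar_algebra = complex_vector + real_normed_algebra + banach +
  fixes star :: "'a \<Rightarrow> 'a"
  assumes norm_scaleC: "norm (c *\<^sub>C x) = cmod c * norm x"
    and mult_scaleC_left: "(c *\<^sub>C x) * y = c *\<^sub>C (x * y)"
    and mult_scaleC_right: "x * (c *\<^sub>C y) = c *\<^sub>C (x * y)"
    and star_add: "star (x + y) = star x + star y"
    and star_scaleC: "star (c *\<^sub>C x) = cnj c *\<^sub>C star x"
    and star_mult: "star (x * y) = star y * star x"
    and star_star: "star (star x) = x"
    and cstar_identity: "norm (star x * x) = (norm x)\<^sup>2"

instantiation complex :: cstar_algebra
begin

definition scaleC_complex :: "complex \<Rightarrow> complex \<Rightarrow> complex"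
  where "scaleC_complex c x = c * x"

definition star_complex :: "complex \<Rightarrow> complex"
  where "star_complex = cnj"

instance
  by standard
    (simp_all add: scaleC_complex_def star_complex_def algebra_simps scaleR_conv_of_real
      norm_mult power2_eq_square)

end

definition unital :: "'a::cstar_algebra itself \<Rightarrow> bool"
  where "unital _ \<longleftrightarrow> (\<exists>e::'a. \<forall>a. e * a = a \<and> a * e = a)"

definition separable :: "'a::topological_space itself \<Rightarrow> bool"
  where "separable _ \<longleftrightarrow> (\<exists>D::'a set. countable D \<and> closure D = UNIV)"

definition positive :: "'a::cstar_algebra \<Rightarrow> bool"
  where "positive a \<longleftrightarrow> (\<exists>b. a = star b * b)"

text \<open>States: positive complex-linear functionals of norm one.\<close>

definition is_state :: "('a::cstar_algebra \<Rightarrow> complex) \<Rightarrow> bool"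
  where "is_state \<phi> \<longleftrightarrow>
    bounded_linear \<phi> \<and> (\<forall>c x. \<phi> (c *\<^sub>C x) = c * \<phi> x) \<and>
    (\<forall>a. \<phi> (star a * a) \<in> \<real> \<and> 0 \<le> Re (\<phi> (star a * a))) \<and>
    onorm \<phi> = 1"

text \<open>Since a state is real on positive elements, only the real part has to be compared with 0.\<close>

definition strictly_positive :: "'a::cstar_algebra \<Rightarrow> bool"
  where "strictly_positive h \<longleftrightarrow> positive h \<and> (\<forall>\<phi>. is_state \<phi> \<longrightarrow> 0 < Re (\<phi> h))"

section \<open>Hilbert modules\<close>

text \<open>
  A right Hilbert module over \<open>'a\<close>: the norm is the one given by the inner product, and
  completeness is part of the class constraint on \<open>'v\<close>. Definiteness of the inner product
  follows from \<open>norm_ip\<close>.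
\<close>

locale hilbert_module =
  fixes act :: "'v::{complex_vector,banach} \<Rightarrow> 'a::cstar_algebra \<Rightarrow> 'v"  (infixl \<open>\<cdot>\<close> 70)
    and ip :: "'v \<Rightarrow> 'v \<Rightarrow> 'a"
  assumes act_add_left: "(x + y) \<cdot> a = x \<cdot> a + y \<cdot> a"
    and act_add_right: "x \<cdot> (a + b) = x \<cdot> a + x \<cdot> b"
    and act_mult: "x \<cdot> (a * b) = x \<cdot> a \<cdot> b"
    and act_scaleC_left: "(c *\<^sub>C x) \<cdot> a = c *\<^sub>C (x \<cdot> a)"
    and act_scaleC_right: "x \<cdot> (c *\<^sub>C a) = c *\<^sub>C (x \<cdot> a)"
    and ip_add_right: "ip x (y + z) = ip x y + ip x z"
    and ip_scaleC_right: "ip x (c *\<^sub>C y) = c *\<^sub>C ip x y"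
    and ip_act_right: "ip x (y \<cdot> a) = ip x y * a"
    and star_ip: "star (ip x y) = ip y x"
    and ip_positive: "positive (ip x x)"
    and norm_ip: "(norm x)\<^sup>2 = norm (ip x x)"

text \<open>
  The notions below depend on the module only through its inner product, which is therefore
  their only module argument. Note that \<open>tau_convergent\<close> does not ask for a limit in the module:
  the inner products with each \<open>z\<close> converge in the algebra, and the limits need not be of the
  form \<open>ip z x\<close>.
\<close>

definition tau_convergent ::
    "('v::real_normed_vector \<Rightarrow> 'v \<Rightarrow> 'a::cstar_algebra) \<Rightarrow> (nat \<Rightarrow> 'v) \<Rightarrow> bool"
  where "tau_convergent ip x \<longleftrightarrow> (\<forall>z. convergent (\<lambda>n. ip z (x n)))"

definition module_Schur :: "('v::real_normed_vector \<Rightarrow> 'v \<Rightarrow> 'a::cstar_algebra) \<Rightarrow> bool"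
  where "module_Schur ip \<longleftrightarrow> (\<forall>x. tau_convergent ip x \<longrightarrow> convergent x)"

text \<open>Sequences are indexed from 0, so the \<open>k\<close>-th mean has \<open>Suc k\<close> terms.\<close>

definition mBS2 :: "('v::real_normed_vector \<Rightarrow> 'v \<Rightarrow> 'a::cstar_algebra) \<Rightarrow> bool"
  where "mBS2 ip \<longleftrightarrow>
    (\<forall>x. tau_convergent ip x \<longrightarrow>
      (\<exists>r::nat \<Rightarrow> nat. strict_mono r \<and>
        convergent (\<lambda>k. (1 / real (Suc k)) *\<^sub>R (\<Sum>i\<le>k. x (r i)))))"

definition self_ip :: "'a::cstar_algebra \<Rightarrow> 'a \<Rightarrow> 'a"
  where "self_ip a b = star a * b"

lemma hilbert_module_self:
  "hilbert_module (\<lambda>x a :: 'a::cstar_algebra. x * a) self_ip"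
  by standard
    (auto simp: self_ip_def positive_def algebra_simps mult_scaleC_left mult_scaleC_right
      star_mult star_star cstar_identity)

end

theory Submission
  imports Defs
begin

text \<open>
  A unital algebra has the module Schur property because \<open>\<langle>1, x\<^sub>n\<rangle> = x\<^sub>n\<close>, and this property implies
  (mBS2) because arithmetic means inherit limits. For the way back, it suffices to find a sequence \<open>u\<close> with
  \<open>a u\<^sub>n \<rightarrow> a\<close> for all \<open>a\<close>: it is \<open>\<tau>\<close>-convergent, and the limit \<open>e\<close> of the means of a subsequence
  satisfies \<open>a e = a\<close> for all \<open>a\<close>.

  For finitely many elements, contractions \<open>m = 1 - u\<close> with small \<open>a m\<close> are products
  of averages of powers of \<open>1 - b\<^sup>2\<close> with self-adjoint \<open>b\<close>; this settles the separable case. If \<open>h\<close> is strictly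
  positive, choose \<open>m\<^sub>n\<close> with \<open>h m\<^sub>n \<rightarrow> 0\<close>. For every \<open>a\<close> and every \<open>e > 0\<close> there is some \<open>c\<close> with
  \<open>a\<^sup>*a \<le> e + c h\<close>, since otherwise the Hahn--Banach theorem gives a state vanishing at \<open>h\<close>; hence
  \<open>a m\<^sub>n \<rightarrow> 0\<close>. The order is that of the multiplier algebra, which supplies a unit without
  requiring a case distinction on whether the algebra already has one.
\<close>

section \<open>Averages and sublinear functionals\<close>

text \<open>Split at an index \<open>N\<close> beyond which all terms lie within
  \<open>e / 2\<close> of \<open>L\<close>. The earlier terms contribute the fixed total
  \<open>C\<close>, which division by \<open>Suc k\<close> makes small.\<close>

lemma tendsto_arithmetic_mean:
  fixes X :: "nat \<Rightarrow> 'b::real_normed_vector"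
  assumes "X \<longlonglongrightarrow> L"
  shows "(\<lambda>k. (1 / real (Suc k)) *\<^sub>R (\<Sum>i\<le>k. X i)) \<longlonglongrightarrow> L"
proof (rule LIMSEQ_I)
  fix e :: real assume "0 < e"
  then obtain N where N: "\<And>n. n \<ge> N \<Longrightarrow> norm (X n - L) < e / 2"
    using LIMSEQ_D[OF assms, of "e / 2"] by auto
  define C where "C = (\<Sum>i<N. norm (X i - L))"
  have C0: "0 \<le> C"
    by (simp add: C_def sum_nonneg)
  obtain M :: nat where M: "2 * C / e < real M"
    using reals_Archimedean2 by blast
  have "norm ((1 / real (Suc k)) *\<^sub>R (\<Sum>i\<le>k. X i) - L) < e" if k: "k \<ge> max N M" for k
  proof -
    have "(\<Sum>i\<le>k. norm (X i - L)) = C + (\<Sum>i\<in>{N..k}. norm (X i - L))"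
    proof -
      have "{..k} = {..<N} \<union> {N..k}"
        using k by auto
      then show ?thesis
        unfolding C_def by (simp add: sum.union_disjoint disjoint_iff)
    qed
    also have "(\<Sum>i\<in>{N..k}. norm (X i - L)) \<le> real (card {N..k}) * (e / 2)"
      using N by (intro sum_bounded_above) (auto intro: less_imp_le)
    also have "\<dots> \<le> real (Suc k) * (e / 2)"
      using \<open>0 < e\<close> by (intro mult_right_mono) auto
    finally have 1: "(\<Sum>i\<le>k. norm (X i - L)) \<le> C + real (Suc k) * (e / 2)"
      by simp
    have "real M < real (Suc k)"
      using k by simp
    then have "2 * C / e < real (Suc k)"
      using M by linarith
    then have 2: "C < real (Suc k) * (e / 2)"
      using \<open>0 < e\<close> by (simp add: field_simps)
    have "(1 / real (Suc k)) *\<^sub>R (\<Sum>i\<le>k. X i) - L = (1 / real (Suc k)) *\<^sub>R (\<Sum>i\<le>k. X i - L)"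
      by (simp add: sum_subtractf scaleR_diff_right sum_constant_scaleR)
    then have "norm ((1 / real (Suc k)) *\<^sub>R (\<Sum>i\<le>k. X i) - L)
        \<le> (1 / real (Suc k)) * (\<Sum>i\<le>k. norm (X i - L))"
      using norm_sum[of "\<lambda>i. X i - L" "{..k}"] by (simp add: divide_right_mono)
    also have "\<dots> < e"
      using 1 2 by (simp add: field_simps)
    finally show ?thesis .
  qed
  then show "\<exists>N. \<forall>k\<ge>N. norm ((1 / real (Suc k)) *\<^sub>R (\<Sum>i\<le>k. X i) - L) < e"
    by blast
qed

section \<open>The Hahn-Banach theorem for sublinear functionals\<close>

definition sublinear :: "('v::real_vector \<Rightarrow> real) \<Rightarrow> bool"
  where "sublinear p \<longleftrightarrow>
    (\<forall>x y. p (x + y) \<le> p x + p y) \<and> (\<forall>r x. 0 < r \<longrightarrow> p (r *\<^sub>R x) \<le> r * p x)"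

lemma sublinear_add: "sublinear p \<Longrightarrow> p (x + y) \<le> p x + p y"
  by (simp add: sublinear_def)

lemma sublinear_scaleR:
  assumes "sublinear p" "0 < r"
  shows "p (r *\<^sub>R x) = r * p x"
proof (rule antisym)
  show "p (r *\<^sub>R x) \<le> r * p x"
    using assms by (simp add: sublinear_def)
  have "p ((1 / r) *\<^sub>R (r *\<^sub>R x)) \<le> (1 / r) * p (r *\<^sub>R x)"
    using assms unfolding sublinear_def by (meson zero_less_divide_1_iff)
  then show "r * p x \<le> p (r *\<^sub>R x)"
    using assms(2) by (simp add: field_simps)
qed

lemma sublinear_0: "sublinear p \<Longrightarrow> p 0 = 0"
  using sublinear_scaleR[of p 2 0] by simp

lemma sublinear_uminus: "sublinear p \<Longrightarrow> - p (- x) \<le> p x"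
  using sublinear_add[of p x "- x"] sublinear_0[of p] by simp

text \<open>The functional \<open>q'\<close> is the infimum of \<open>q (x + t y) - t q y\<close>
  over \<open>t \<ge> 0\<close>; taking \<open>t = 1\<close> at \<open>- y\<close> gives the last
  claim. It serves twice: to show that minimal functionals are odd, and to force equality at a given
  point.\<close>

lemma sublinear_decrease:
  fixes q :: "'v::real_vector \<Rightarrow> real"
  assumes q: "sublinear q"
  obtains q' where "sublinear q'" "\<And>x. q' x \<le> q x" "q' (- y) \<le> - q y"
proof -
  define A where "A x = (\<lambda>t. q (x + t *\<^sub>R y) - t * q y) ` {0..}" for x
  define q' where "q' x = Inf (A x)" for x
  \<comment> \<open>Subadditivity for \<open>t y = (x + t y) + (- x)\<close> bounds the infimum from
    below, independently of \<open>t\<close>.\<close>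
  have lower: "- q (- x) \<le> q (x + t *\<^sub>R y) - t * q y" if "0 \<le> t" for x t
  proof -
    have "q (t *\<^sub>R y) = t * q y"
      using that sublinear_scaleR[OF q, of t y] sublinear_0[OF q] by (cases "t = 0") auto
    then show ?thesis
      using sublinear_add[OF q, of "x + t *\<^sub>R y" "- x"] by simp
  qed
  have bdd: "bdd_below (A x)" for x
    using lower unfolding A_def by (intro bdd_belowI[of _ "- q (- x)"]) auto
  have le: "q' x \<le> q (x + t *\<^sub>R y) - t * q y" if "0 \<le> t" for x t
    unfolding q'_def using that by (intro cInf_lower bdd) (auto simp: A_def)
  have greatest: "c \<le> q' x" if "\<And>t. 0 \<le> t \<Longrightarrow> c \<le> q (x + t *\<^sub>R y) - t * q y" for c x
    unfolding q'_def using that by (intro cInf_greatest) (auto simp: A_def)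
  have add: "q' (x + z) \<le> q' x + q' z" for x z
  proof -
    have *: "q' (x + z) \<le> (q (x + t *\<^sub>R y) - t * q y) + (q (z + s *\<^sub>R y) - s * q y)"
      if "0 \<le> t" "0 \<le> s" for t s
    proof -
      have "q' (x + z) \<le> q ((x + z) + (t + s) *\<^sub>R y) - (t + s) * q y"
        using that by (intro le) simp
      also have "(x + z) + (t + s) *\<^sub>R y = (x + t *\<^sub>R y) + (z + s *\<^sub>R y)"
        by (simp add: algebra_simps)
      finally show ?thesis
        using sublinear_add[OF q, of "x + t *\<^sub>R y" "z + s *\<^sub>R y"] by (simp add: algebra_simps)
    qed
    have "q' (x + z) - (q (z + s *\<^sub>R y) - s * q y) \<le> q' x" if "0 \<le> s" for s
      using *[OF _ that] by (intro greatest) (simp add: algebra_simps)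
    then have "q' (x + z) - q' x \<le> q' z"
      by (intro greatest) (simp add: algebra_simps)
    then show ?thesis
      by simp
  qed
  have scale: "q' (r *\<^sub>R x) \<le> r * q' x" if r: "0 < r" for r x
  proof -
    have "q' (r *\<^sub>R x) / r \<le> q' x"
    proof (rule greatest)
      fix t :: real assume t: "0 \<le> t"
      have "q' (r *\<^sub>R x) \<le> q (r *\<^sub>R x + (r * t) *\<^sub>R y) - (r * t) * q y"
        using r t by (intro le) simp
      also have "r *\<^sub>R x + (r * t) *\<^sub>R y = r *\<^sub>R (x + t *\<^sub>R y)"
        by (simp add: scaleR_add_right)
      also have "q \<dots> = r * q (x + t *\<^sub>R y)"
        by (rule sublinear_scaleR[OF q r])
      finally show "q' (r *\<^sub>R x) / r \<le> q (x + t *\<^sub>R y) - t * q y"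
        using r by (simp add: field_simps)
    qed
    then show ?thesis
      using r by (simp add: field_simps)
  qed
  show thesis
  proof
    show "sublinear q'"
      using add scale by (simp add: sublinear_def)
    show "q' x \<le> q x" for x
      using le[of 0 x] by simp
    show "q' (- y) \<le> - q y"
      using le[of 1 "- y"] sublinear_0[OF q] by simp
  qed
qed

text \<open>
  A sublinear functional that is minimal for the pointwise order is linear, so Zorn's lemma
  can be applied to total functionals and no partial extensions have to be handled.
\<close>

lemma sublinear_minorant:
  fixes p :: "'v::real_vector \<Rightarrow> real"
  assumes p: "sublinear p"
  obtains f where "linear f" "\<And>x. f x \<le> p x"
proof -
  define A where "A = {q. sublinear q \<and> (\<forall>x. q x \<le> p x)}"
  define P where "P a b \<longleftrightarrow> (\<forall>x. b x \<le> a x)" for a b :: "'v \<Rightarrow> real"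
  have "\<exists>m\<in>A. \<forall>a\<in>A. P m a \<longrightarrow> a = m"
  proof (rule predicate_Zorn)
    show "partial_order_on A (relation_of P A)"
      by (rule partial_order_on_relation_ofI) (auto simp: P_def fun_eq_iff intro: order_trans antisym)
    fix C assume C: "C \<in> Chains (relation_of P A)"
    show "\<exists>u\<in>A. \<forall>a\<in>C. P a u"
    proof (cases "C = {}")
      case True
      then show ?thesis
        using p by (auto simp: A_def)
    next
      case False
      have CA: "C \<subseteq> A" and tot: "\<And>a b. a \<in> C \<Longrightarrow> b \<in> C \<Longrightarrow> P a b \<or> P b a"
        using C by (auto simp: Chains_def relation_of_def)
      define u where "u x = (INF q\<in>C. q x)" for x
      \<comment> \<open>This lower bound is the same for all sublinear functionals below
        \<open>p\<close>, so the pointwise infimum of the chain is finite.\<close>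
      have "- p (- x) \<le> q x" if "q \<in> C" for q x
        using that CA sublinear_uminus[of q x] unfolding A_def
        by (smt (verit, best) mem_Collect_eq subset_iff)
      then have bdd: "bdd_below ((\<lambda>q. q x) ` C)" for x
        by (intro bdd_belowI[of _ "- p (- x)"]) auto
      have le: "u x \<le> q x" if "q \<in> C" for q x
        unfolding u_def using that bdd by (intro cINF_lower) auto
      have greatest: "c \<le> u x" if "\<And>q. q \<in> C \<Longrightarrow> c \<le> q x" for c x
        unfolding u_def using that False by (intro cINF_greatest) auto
      have "u (x + y) \<le> u x + u y" for x y
      proof -
        \<comment> \<open>Infima of sublinear functionals need not be subadditive; here the smaller
          of \<open>a\<close> and \<open>b\<close>, which exists in a chain, serves at both
          points.\<close>
        have *: "u (x + y) \<le> a x + b y" if ab: "a \<in> C" "b \<in> C" for a b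
        proof -
          obtain c where c: "c \<in> C" "c x \<le> a x" "c y \<le> b y"
            using tot[OF ab] ab unfolding P_def by blast
          then have "u (x + y) \<le> c x + c y"
            using CA le[of c "x + y"] sublinear_add[of c x y] by (auto simp: A_def)
          then show ?thesis
            using c by linarith
        qed
        have "u (x + y) - b y \<le> u x" if "b \<in> C" for b
          using *[OF _ that] by (intro greatest) (simp add: algebra_simps)
        then have "u (x + y) - u x \<le> u y"
          by (intro greatest) (simp add: algebra_simps)
        then show ?thesis
          by simp
      qed
      moreover have "u (r *\<^sub>R x) \<le> r * u x" if r: "0 < r" for r x
      proof -
        have "u (r *\<^sub>R x) / r \<le> u x"
        proof (rule greatest)
          fix q assume q: "q \<in> C"
          then have "q (r *\<^sub>R x) = r * q x"
            using CA r by (auto simp: A_def sublinear_scaleR)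
          then show "u (r *\<^sub>R x) / r \<le> q x"
            using le[OF q, of "r *\<^sub>R x"] r by (simp add: field_simps)
        qed
        then show ?thesis
          using r by (simp add: field_simps)
      qed
      ultimately have "sublinear u"
        by (simp add: sublinear_def)
      moreover have "u x \<le> p x" for x
      proof -
        obtain q where "q \<in> C"
          using False by blast
        moreover have "q x \<le> p x"
          using \<open>q \<in> C\<close> CA by (auto simp: A_def)
        ultimately show ?thesis
          using le[of q x] by linarith
      qed
      ultimately show ?thesis
        using le by (auto simp: A_def P_def)
    qed
  qed
  then obtain f where "f \<in> A" and least: "\<And>q. q \<in> A \<Longrightarrow> P f q \<Longrightarrow> q = f"
    by blast
  then have f: "sublinear f" "\<And>x. f x \<le> p x"
    by (simp_all add: A_def)
  have min: "q = f" if q: "sublinear q" "\<And>x. q x \<le> f x" for q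
  proof (rule least)
    have "q x \<le> p x" for x
      using q(2)[of x] f(2)[of x] by linarith
    then show "q \<in> A"
      using q(1) by (simp add: A_def)
    show "P f q"
      using q(2) by (simp add: P_def)
  qed
  \<comment> \<open>By minimality, lowering \<open>f\<close> in direction \<open>y\<close> returns
    \<open>f\<close> itself, so the inequality produced by the lowering holds for
    \<open>f\<close>.\<close>
  have neg: "f (- y) = - f y" for y
  proof -
    obtain q where "sublinear q" "\<And>x. q x \<le> f x" "q (- y) \<le> - f y"
      using sublinear_decrease[OF f(1)] by blast
    then have "f (- y) \<le> - f y"
      using min by metis
    then show ?thesis
      using sublinear_uminus[OF f(1), of y] by linarith
  qed
  have add: "f (x + y) = f x + f y" for x y
    using sublinear_add[OF f(1), of x y] sublinear_add[OF f(1), of "- x" "- y"]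
      neg[of "x + y"] neg[of x] neg[of y] by simp
  have "f (r *\<^sub>R x) = r * f x" for r x
  proof (cases r "0::real" rule: linorder_cases)
    case less
    then show ?thesis
      using sublinear_scaleR[OF f(1), of "- r" x] neg[of "r *\<^sub>R x"] by simp
  qed (use sublinear_scaleR[OF f(1)] sublinear_0[OF f(1)] in auto)
  then have "linear f"
    using add by (intro linearI) auto
  with f(2) show thesis
    by (rule that[rotated])
qed

text \<open>Lowering \<open>p\<close> in direction \<open>y\<close> first pins the value: every
  linear \<open>f\<close> below the lowered functional satisfies
  \<open>- f y = f (- y) \<le> - p y\<close>.\<close>

lemma Hahn_Banach_support:
  fixes p :: "'v::real_vector \<Rightarrow> real"
  assumes p: "sublinear p"
  obtains f where "linear f" "\<And>x. f x \<le> p x" "f y = p y"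
proof -
  obtain q where q: "sublinear q" "\<And>x. q x \<le> p x" "q (- y) \<le> - p y"
    using sublinear_decrease[OF p] by blast
  obtain f where f: "linear f" "\<And>x. f x \<le> q x"
    using sublinear_minorant[OF q(1)] by blast
  have "- f y \<le> - p y"
    using f(2)[of "- y"] q(3) linear_neg[OF f(1), of y] by linarith
  moreover have le: "f x \<le> p x" for x
    using f(2) q(2) order_trans by blast
  ultimately show thesis
    using f(1) by (intro that[of f]) (auto intro: antisym)
qed

section \<open>The involution\<close>

lemma scaleC_zero_right [simp]: "c *\<^sub>C (0::'a::complex_vector) = 0"
  using scaleC_add_right[of c 0 "0::'a"] by simp

lemma scaleC_minus_right [simp]: "c *\<^sub>C (- x) = - (c *\<^sub>C (x::'a::complex_vector))"
  using scaleC_add_right[of c x "- x"] by (simp add: eq_neg_iff_add_eq_0 add.commute)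

lemma scaleC_diff_right: "c *\<^sub>C (x - y) = c *\<^sub>C x - c *\<^sub>C (y::'a::complex_vector)"
  using scaleC_add_right[of c x "- y"] by simp

lemma scaleC_of_real [simp]: "complex_of_real r *\<^sub>C x = r *\<^sub>R (x::'a::complex_vector)"
  by (simp add: scaleR_scaleC)

lemma scaleC_one [simp]: "1 *\<^sub>C x = (x::'a::complex_vector)"
  using scaleC_of_real[of 1 x] by simp

lemma scaleC_scaleR_right: "c *\<^sub>C (r *\<^sub>R x) = r *\<^sub>R (c *\<^sub>C (x::'a::complex_vector))"
  by (simp add: scaleR_scaleC scaleC_scaleC mult.commute del: scaleC_of_real)

lemma scaleC_ii_ii [simp]: "\<i> *\<^sub>C \<i> *\<^sub>C x = - (x::'a::complex_vector)"
  using scaleC_of_real[of "- 1" x] by (simp add: scaleC_scaleC)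

lemma scaleC_minus_ii [simp]: "(- \<i>) *\<^sub>C x = - (\<i> *\<^sub>C (x::'a::complex_vector))"
  using scaleC_add_left[of \<i> "- \<i>" x] scaleC_of_real[of 0 x]
  by (simp add: eq_neg_iff_add_eq_0 add.commute)

lemma scaleC_Complex:
  "c *\<^sub>C x = Re c *\<^sub>R x + Im c *\<^sub>R (\<i> *\<^sub>C (x::'a::complex_vector))"
proof -
  have "c *\<^sub>C x = (complex_of_real (Re c) + complex_of_real (Im c) * \<i>) *\<^sub>C x"
    by (simp add: complex_eq[symmetric] mult.commute)
  then show ?thesis
    by (simp only: scaleC_add_left scaleC_scaleC[symmetric] scaleC_of_real)
qed

lemma star_0 [simp]: "star (0::'a::cstar_algebra) = 0"
  using star_add[of 0 "0::'a"] by simp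

lemma star_uminus [simp]: "star (- x) = - star (x::'a::cstar_algebra)"
  using star_add[of x "- x"] by (simp add: eq_neg_iff_add_eq_0 add.commute)

lemma star_diff: "star (x - y) = star x - star (y::'a::cstar_algebra)"
  using star_add[of x "- y"] by simp

lemma star_scaleR [simp]: "star (r *\<^sub>R x) = r *\<^sub>R star (x::'a::cstar_algebra)"
  using star_scaleC[of "complex_of_real r" x] by simp

lemma star_ii [simp]: "star (\<i> *\<^sub>C x) = - (\<i> *\<^sub>C star (x::'a::cstar_algebra))"
  by (simp add: star_scaleC)

lemma norm_star [simp]: "norm (star x) = norm (x::'a::cstar_algebra)"
proof -
  have *: "norm x \<le> norm (star x)" for x :: 'a
  proof (cases "x = 0")
    case False
    have "norm x * norm x \<le> norm (star x) * norm x"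
      using norm_mult_ineq[of "star x" x] cstar_identity[of x] by (simp add: power2_eq_square)
    then show ?thesis
      using False by simp
  qed simp
  show ?thesis
    using *[of x] *[of "star x"] by (simp add: star_star)
qed

lemma norm_mult_star: "norm (x * star x) = (norm (x::'a::cstar_algebra))\<^sup>2"
  using cstar_identity[of "star x"] by (simp add: star_star)

lemma bounded_linear_star: "bounded_linear (star :: 'a::cstar_algebra \<Rightarrow> 'a)"
  by (rule bounded_linear_intro[where K = 1]) (simp_all add: star_add)

lemma star_mult_eq_0_iff [simp]: "star x * x = 0 \<longleftrightarrow> x = (0::'a::cstar_algebra)"
  using cstar_identity[of x] by auto

definition self_adjoint :: "'a::cstar_algebra \<Rightarrow> bool"
  where "self_adjoint a \<longleftrightarrow> star a = a"

lemma self_adjoint_0 [simp]: "self_adjoint (0::'a::cstar_algebra)"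
  and self_adjoint_add: "self_adjoint x \<Longrightarrow> self_adjoint y \<Longrightarrow> self_adjoint (x + y)"
  and self_adjoint_diff: "self_adjoint x \<Longrightarrow> self_adjoint y \<Longrightarrow> self_adjoint (x - y)"
  and self_adjoint_scaleR: "self_adjoint x \<Longrightarrow> self_adjoint (r *\<^sub>R x)"
  and self_adjoint_star_mult [simp]: "self_adjoint (star z * z)"
  and self_adjoint_mult_star [simp]: "self_adjoint (z * star z)"
  for x y z :: "'a::cstar_algebra"
  by (simp_all add: self_adjoint_def star_add star_diff star_mult star_star)

lemma self_adjoint_mult:
  "self_adjoint x \<Longrightarrow> self_adjoint y \<Longrightarrow> x * y = y * x \<Longrightarrow> self_adjoint (x * y)"
  by (simp add: self_adjoint_def star_mult)

lemma self_adjoint_conjugate: "self_adjoint x \<Longrightarrow> self_adjoint (star m * x * m)"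
  by (simp add: self_adjoint_def star_mult star_star mult.assoc)

lemma norm_square_self_adjoint: "self_adjoint x \<Longrightarrow> norm (x * x) = (norm x)\<^sup>2"
  using cstar_identity[of x] by (simp add: self_adjoint_def)

text \<open>Here \<open>a\<close> is the real part of \<open>w\<close> and \<open>b\<close> is minus
  its imaginary part. The mixed terms of the two products cancel in the sum, which makes positivity
  visible before it is known for \<open>star w * w\<close> alone.\<close>

lemma mult_star_plus_star_mult:
  fixes w :: "'a::cstar_algebra"
  obtains a b where "self_adjoint a" "self_adjoint b"
    "star w * w + w * star w = 2 *\<^sub>R (a * a + b * b)"
proof -
  define s where "s = star w"
  let ?a = "(1/2) *\<^sub>R (w + s)" and ?b = "(1/2) *\<^sub>R (\<i> *\<^sub>C (w - s))"
  have [simp]: "star w = s" "star s = w"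
    by (simp_all add: s_def star_star)
  have sa: "self_adjoint ?a" "self_adjoint ?b"
    by (simp_all add: self_adjoint_def star_add star_diff scaleC_diff_right add.commute)
  have "?b * ?b = - ((1/4) *\<^sub>R ((w - s) * (w - s)))"
    by (simp add: mult_scaleC_left mult_scaleC_right scaleC_scaleR_right)
  moreover have "?a * ?a = (1/4) *\<^sub>R ((w + s) * (w + s))"
    by simp
  moreover have "(w + s) * (w + s) - (w - s) * (w - s) = 2 *\<^sub>R (s * w + w * s)"
    by (simp add: algebra_simps scaleR_2)
  ultimately have "?a * ?a + ?b * ?b = (1/4) *\<^sub>R (2 *\<^sub>R (s * w + w * s))"
    by (metis scaleR_diff_right add_uminus_conv_diff)
  then have "star w * w + w * star w = 2 *\<^sub>R (?a * ?a + ?b * ?b)"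
    by simp
  with sa show thesis
    by (rule that)
qed

section \<open>Positivity in unital C*-algebras\<close>

text \<open>
  The library class \<^class>\<open>ring_1\<close> demands \<open>0 \<noteq> 1\<close>, which fails for the multipliers of the zero
  algebra. Hence the unit is added by \<^class>\<open>monoid_mult\<close>.
\<close>

class cstar_algebra_1 = cstar_algebra + monoid_mult

lemma star_1 [simp]: "star 1 = (1::'b::cstar_algebra_1)"
  by (metis mult_1_left mult_1_right star_mult star_star)

text \<open>Only an inequality, since the unit of the zero algebra has norm 0.\<close>

lemma norm_1_le: "norm (1::'b::cstar_algebra_1) \<le> 1"
proof -
  have "norm (1::'b) * norm (1::'b) = 1 * norm (1::'b)"
    using cstar_identity[of "1::'b"] by (simp add: power2_eq_square)
  then show ?thesis
    by (metis mult_cancel_right order_refl zero_le_one)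
qed

lemma self_adjoint_1 [simp]: "self_adjoint (1::'b::cstar_algebra_1)"
  by (simp add: self_adjoint_def)

lemma self_adjoint_power: "self_adjoint x \<Longrightarrow> self_adjoint (x ^ n :: 'b::cstar_algebra_1)"
  by (induction n) (auto simp: self_adjoint_def star_mult power_commutes)

text \<open>Iterated C*-identity. It later turns a bound on all even powers into a bound by 1 on the
  norm.\<close>

lemma norm_power_self_adjoint:
  fixes x :: "'b::cstar_algebra_1"
  assumes "self_adjoint x"
  shows "norm (x ^ (2 ^ n)) = norm x ^ (2 ^ n)"
proof (induction n)
  case (Suc n)
  have "x ^ (2 ^ Suc n) = x ^ (2 ^ n) * x ^ (2 ^ n)"
    by (simp add: power_add[symmetric] mult_2)
  then show ?case
    using norm_square_self_adjoint[OF self_adjoint_power[OF assms, of "2 ^ n"]] Suc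
    by (simp add: power_mult[symmetric] mult.commute)
qed simp

text \<open>The root is \<open>1 - g\<close>, where \<open>g\<close> is the fixed point of the contraction \<open>g \<mapsto> (c + g\<^sup>2) / 2\<close>.\<close>

lemma square_root_one_minus:
  fixes c :: "'b::cstar_algebra_1"
  assumes sa: "self_adjoint c" and c1: "norm c < 1"
  obtains k where "self_adjoint k" "k * k = 1 - c" "\<And>z. z * c = c * z \<Longrightarrow> z * k = k * z"
proof -
  define \<rho> where "\<rho> = norm c"
  define f where "f g = (1/2) *\<^sub>R (c + g * g)" for g :: 'b
  \<comment> \<open>All properties wanted of the fixed point are closed conditions, so they are
    built into the complete set on which \<open>f\<close> contracts: the norm bound,
    self-adjointness, and commutation with everything that commutes with \<open>c\<close>.\<close>
  define S where "S = cball 0 \<rho> \<inter> {g. star g = g} \<inter> (\<Inter>z\<in>{z. z * c = c * z}. {g. z * g = g * z})"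
  have cont_star: "continuous_on UNIV (star :: 'b \<Rightarrow> 'b)"
    by (intro linear_continuous_on bounded_linear_star)
  have "closed {g::'b. star g = g}"
    by (intro closed_Collect_eq cont_star continuous_intros)
  moreover have "closed (\<Inter>z\<in>{z. z * c = c * z}. {g. z * g = g * z})"
    by (intro closed_INT ballI closed_Collect_eq continuous_intros)
  ultimately have "complete S"
    unfolding S_def by (simp add: complete_eq_closed closed_Int)
  moreover have "0 \<in> S"
    by (auto simp: S_def \<rho>_def)
  moreover have "f ` S \<subseteq> S"
  proof (intro image_subsetI)
    fix g assume g: "g \<in> S"
    have gn: "norm g \<le> \<rho>" and gs: "star g = g" and gz: "\<And>z. z * c = c * z \<Longrightarrow> z * g = g * z"
      using g by (auto simp: S_def)
    have "norm (g * g) \<le> norm g * norm g"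
      by (rule norm_mult_ineq)
    also have "\<dots> \<le> \<rho> * 1"
      using gn c1 by (intro mult_mono) (auto simp: \<rho>_def)
    finally have "norm (c + g * g) \<le> \<rho> + \<rho>"
      using norm_triangle_ineq[of c "g * g"] by (simp add: \<rho>_def)
    then have "norm (f g) \<le> \<rho>"
      by (simp add: f_def)
    moreover have "star (f g) = f g"
      using gs sa by (simp add: f_def star_add star_mult self_adjoint_def)
    moreover have "z * f g = f g * z" if "z * c = c * z" for z
      using gz[OF that] that by (simp add: f_def algebra_simps) (metis mult.assoc)
    ultimately show "f g \<in> S"
      by (auto simp: S_def)
  qed
  moreover have "\<forall>x\<in>S. \<forall>y\<in>S. dist (f x) (f y) \<le> \<rho> * dist x y"
  proof (intro ballI)
    fix x y assume xy: "x \<in> S" "y \<in> S"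
    have "x * x - y * y = x * (x - y) + (x - y) * y"
      by (simp add: algebra_simps)
    then have "norm (x * x - y * y) \<le> norm x * norm (x - y) + norm (x - y) * norm y"
      using norm_triangle_mono[OF norm_mult_ineq norm_mult_ineq] by metis
    also have "\<dots> \<le> \<rho> * norm (x - y) + norm (x - y) * \<rho>"
      using xy by (intro add_mono mult_left_mono mult_right_mono) (auto simp: S_def)
    finally have "norm (x * x - y * y) \<le> 2 * (\<rho> * norm (x - y))"
      by simp
    moreover have "f x - f y = (1/2) *\<^sub>R (x * x - y * y)"
      by (simp add: f_def algebra_simps)
    ultimately show "dist (f x) (f y) \<le> \<rho> * dist x y"
      by (simp add: dist_norm)
  qed
  ultimately have "\<exists>!g. g \<in> S \<and> f g = g"
    using c1 by (intro Banach_fix[of S \<rho> f]) (auto simp: \<rho>_def)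
  then obtain g where g: "g \<in> S" "f g = g"
    by blast
  have "2 *\<^sub>R f g = c + g * g"
    by (simp add: f_def)
  then have gg: "g + g = c + g * g"
    using g(2) by (simp add: scaleR_2)
  show thesis
  proof
    show "self_adjoint (1 - g)"
      using g(1) by (simp add: S_def self_adjoint_def star_diff)
    have "(1 - g) * (1 - g) = 1 - (g + g) + g * g"
      by (simp add: algebra_simps)
    then show "(1 - g) * (1 - g) = 1 - c"
      by (simp add: gg)
    show "z * (1 - g) = (1 - g) * z" if "z * c = c * z" for z
      using g(1) that by (simp add: S_def algebra_simps)
  qed
qed

text \<open>Here \<open>l \<plusminus> \<i>k\<close> is \<open>\<surd>r\<close> times a unitary.\<close>

lemma norm_le_if_squares_sum:
  fixes l k :: "'b::cstar_algebra_1"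
  assumes sa: "self_adjoint l" "self_adjoint k" and comm: "l * k = k * l"
    and sum: "l * l + k * k = r *\<^sub>R 1" and r: "0 \<le> r"
  shows "(norm l)\<^sup>2 \<le> r"
proof -
  define U where "U = l + \<i> *\<^sub>C k"
  define V where "V = l - \<i> *\<^sub>C k"
  have star: "star U = V" "star V = U"
    using sa by (simp_all add: U_def V_def star_add star_diff self_adjoint_def)
  have "V * U = r *\<^sub>R 1" "U * V = r *\<^sub>R 1"
    using sum comm
    by (simp_all add: U_def V_def algebra_simps mult_scaleC_left mult_scaleC_right
        scaleC_add_right scaleC_diff_right)
  then have "(norm U)\<^sup>2 = norm (r *\<^sub>R (1::'b))" "(norm V)\<^sup>2 = norm (r *\<^sub>R (1::'b))"
    using cstar_identity[of U] cstar_identity[of V] by (simp_all add: star)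
  moreover have "norm (r *\<^sub>R (1::'b)) \<le> r"
    using mult_left_mono[OF norm_1_le r] r by simp
  ultimately have "norm U \<le> sqrt r" "norm V \<le> sqrt r"
    by (simp_all add: real_le_rsqrt)
  moreover have "l = (1/2) *\<^sub>R (U + V)"
    by (simp add: U_def V_def scaleR_2[symmetric])
  ultimately have "norm l \<le> sqrt r"
    using norm_triangle_ineq[of U V] by simp
  then show ?thesis
    using r by (metis norm_ge_zero power_mono real_sqrt_pow2)
qed

section \<open>The positive cone\<close>

text \<open>
  This norm condition makes sums of positive elements positive for free; that it holds for
  \<open>x\<^sup>*x\<close> is the hard part, see \<open>pos_star_mult\<close>.
\<close>

definition pos :: "'b::cstar_algebra_1 \<Rightarrow> bool"
  where "pos a \<longleftrightarrow> self_adjoint a \<and> (\<exists>t\<ge>0. norm (t *\<^sub>R 1 - a) \<le> t)"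

lemma pos_self_adjoint: "pos a \<Longrightarrow> self_adjoint a"
  by (simp add: pos_def)

lemma pos_add:
  assumes "pos a" "pos b"
  shows "pos (a + b)"
proof -
  obtain s t where s: "0 \<le> s" "norm (s *\<^sub>R 1 - a) \<le> s" and t: "0 \<le> t" "norm (t *\<^sub>R 1 - b) \<le> t"
    using assms by (auto simp: pos_def)
  have "(s + t) *\<^sub>R 1 - (a + b) = (s *\<^sub>R 1 - a) + (t *\<^sub>R 1 - b)"
    by (simp add: algebra_simps)
  then have "norm ((s + t) *\<^sub>R 1 - (a + b)) \<le> s + t"
    using norm_triangle_mono[OF s(2) t(2)] by (simp only:)
  then show ?thesis
    using assms s t unfolding pos_def by (auto intro!: self_adjoint_add exI[of _ "s + t"])
qed

lemma pos_scaleR: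
  assumes "pos a" "0 \<le> r"
  shows "pos (r *\<^sub>R a)"
proof -
  obtain s where s: "0 \<le> s" "norm (s *\<^sub>R 1 - a) \<le> s"
    using assms by (auto simp: pos_def)
  have "norm ((r * s) *\<^sub>R 1 - r *\<^sub>R a) = r * norm (s *\<^sub>R 1 - a)"
    using assms(2) by (metis abs_of_nonneg norm_scaleR scaleR_diff_right scaleR_scaleR)
  then have "norm ((r * s) *\<^sub>R 1 - r *\<^sub>R a) \<le> r * s"
    using s assms(2) by (simp add: mult_left_mono)
  then show ?thesis
    using assms s unfolding pos_def by (auto intro!: self_adjoint_scaleR exI[of _ "r * s"])
qed

text \<open>The witness in \<open>pos\<close> is \<open>r\<close>, because subtracting
  \<open>r *\<^sub>R 1 - a\<close> from \<open>r *\<^sub>R 1\<close> leaves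
  \<open>a\<close>.\<close>

lemma pos_norm_minus:
  assumes "self_adjoint a" "norm a \<le> r"
  shows "pos (r *\<^sub>R 1 - a)"
  unfolding pos_def
  using assms norm_ge_zero[of a]
  by (auto intro!: self_adjoint_diff self_adjoint_scaleR exI[of _ r] simp del: norm_ge_zero)

lemma pos_0 [simp]: "pos 0"
  by (auto simp: pos_def)

lemma pos_1: "pos 1"
  using pos_norm_minus[of "0::'b::cstar_algebra_1" 1] by simp

text \<open>Rescale to \<open>c = (t - a) / (t + e)\<close>. The shift by \<open>e\<close> makes
  \<open>norm c\<close> strictly less than 1, as the fixed point construction requires; later
  arguments let the shift tend to 0.\<close>

lemma pos_square_root:
  assumes "pos a" "0 < e"
  obtains k where "self_adjoint k" "k * k = a + e *\<^sub>R 1" "\<And>z. z * a = a * z \<Longrightarrow> z * k = k * z"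
proof -
  obtain t where t: "0 \<le> t" "norm (t *\<^sub>R 1 - a) \<le> t"
    using assms by (auto simp: pos_def)
  define c where "c = (1 / (t + e)) *\<^sub>R (t *\<^sub>R 1 - a)"
  have te: "0 < t + e"
    using t assms(2) by simp
  have "self_adjoint c"
    using pos_self_adjoint[OF assms(1)]
    by (auto simp: c_def intro!: self_adjoint_diff self_adjoint_scaleR)
  moreover have "norm c < 1"
    using t assms(2) te by (simp add: c_def)
  ultimately obtain g where g: "self_adjoint g" "g * g = 1 - c" "\<And>z. z * c = c * z \<Longrightarrow> z * g = g * z"
    using square_root_one_minus by blast
  show thesis
  proof
    show "self_adjoint (sqrt (t + e) *\<^sub>R g)"
      using g(1) by (rule self_adjoint_scaleR)
    have "(sqrt (t + e) *\<^sub>R g) * (sqrt (t + e) *\<^sub>R g) = (t + e) *\<^sub>R (1 - c)"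
      using te by (simp add: g(2))
    also have "(t + e) *\<^sub>R c = t *\<^sub>R 1 - a"
      using te by (simp add: c_def)
    then have "(t + e) *\<^sub>R (1 - c) = a + e *\<^sub>R 1"
      by (simp add: scaleR_diff_right scaleR_add_left)
    finally show "(sqrt (t + e) *\<^sub>R g) * (sqrt (t + e) *\<^sub>R g) = a + e *\<^sub>R 1" .
    show "z * (sqrt (t + e) *\<^sub>R g) = (sqrt (t + e) *\<^sub>R g) * z" if "z * a = a * z" for z
    proof -
      have "z * c = c * z"
        using that by (simp add: c_def algebra_simps)
      then show ?thesis
        using g(3) by simp
    qed
  qed
qed

text \<open>Scale \<open>h\<close> to \<open>l\<close> with \<open>norm (l * l) < 1\<close> and let
  \<open>k\<close> be a root of \<open>1 - l * l\<close> commuting with \<open>l\<close>. The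
  squares of \<open>k\<close> and \<open>l\<close> sum to 1, so
  \<open>norm (1 - l * l) = (norm k)^2 \<le> 1\<close>.\<close>

lemma pos_square:
  fixes h :: "'b::cstar_algebra_1"
  assumes h: "self_adjoint h"
  shows "pos (h * h)"
proof -
  define t where "t = (norm h)\<^sup>2 + 1"
  define l where "l = (1 / sqrt t) *\<^sub>R h"
  have t: "0 < t"
    by (simp add: t_def add_nonneg_pos)
  have l: "self_adjoint l" "l * l = (1 / t) *\<^sub>R (h * h)"
    using h t by (auto simp: l_def intro: self_adjoint_scaleR)
  have "norm (l * l) < 1"
    using t h by (simp add: l(2) norm_square_self_adjoint) (simp add: t_def)
  then obtain k where k: "self_adjoint k" "k * k = 1 - l * l" "\<And>z. z * (l * l) = (l * l) * z \<Longrightarrow> z * k = k * z"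
    using square_root_one_minus[of "l * l"] l(1) self_adjoint_mult by blast
  have "(norm k)\<^sup>2 \<le> 1"
    using k l(1) k(3)[of l] by (intro norm_le_if_squares_sum[of k l 1]) (auto simp: mult.assoc)
  then have "norm (1 - l * l) \<le> 1"
    using norm_square_self_adjoint[OF k(1)] by (simp add: k(2))
  then have "norm (t *\<^sub>R (1 - l * l)) \<le> t"
    using t by simp
  moreover have "t *\<^sub>R (1 - l * l) = t *\<^sub>R 1 - h * h"
    using t by (simp add: l(2) scaleR_diff_right)
  ultimately show ?thesis
    using h t unfolding pos_def by (auto intro!: self_adjoint_mult exI[of _ t])
qed

text \<open>The roots of the shifted elements \<open>a\<close> and \<open>s - a\<close> commute,
  because each root commutes with whatever commutes with its square, and their squares sum to a
  multiple of 1.\<close>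

lemma norm_le_if_pos:
  fixes a :: "'b::cstar_algebra_1"
  assumes a: "pos a" and sa: "pos (s *\<^sub>R 1 - a)" and s: "0 \<le> s"
  shows "norm a \<le> s"
proof (rule field_le_epsilon)
  fix e :: real assume e: "0 < e"
  \<comment> \<open>Each of the two roots costs one shift by \<open>d\<close>, and removing the
    shift from \<open>a\<close> costs a third.\<close>
  define d where "d = e / 3"
  have d: "0 < d" using e by (simp add: d_def)
  obtain l where l: "self_adjoint l" "l * l = a + d *\<^sub>R 1" "\<And>z. z * a = a * z \<Longrightarrow> z * l = l * z"
    using pos_square_root[OF a d] by blast
  obtain k where k: "self_adjoint k" "k * k = s *\<^sub>R 1 - a + d *\<^sub>R 1"
    "\<And>z. z * (s *\<^sub>R 1 - a) = (s *\<^sub>R 1 - a) * z \<Longrightarrow> z * k = k * z"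
    using pos_square_root[OF sa d] by blast
  have "l * a = a * l"
    using l(3)[of a] by simp
  then have "l * k = k * l"
    by (intro k(3)) (simp add: algebra_simps)
  moreover have "l * l + k * k = (s + 2 * d) *\<^sub>R 1"
    unfolding l(2) k(2) mult_2 scaleR_add_left by simp
  ultimately have "(norm l)\<^sup>2 \<le> s + 2 * d"
    using l(1) k(1) s d by (intro norm_le_if_squares_sum) auto
  then have "norm (a + d *\<^sub>R 1) \<le> s + 2 * d"
    using norm_square_self_adjoint[OF l(1)] by (simp add: l(2))
  moreover have "norm (d *\<^sub>R (1::'b)) \<le> d"
    using mult_left_mono[OF norm_1_le[where 'b = 'b], of d] d by simp
  moreover have "norm a \<le> norm (a + d *\<^sub>R 1) + norm (d *\<^sub>R (1::'b))"
    using norm_triangle_ineq4[of "a + d *\<^sub>R 1" "d *\<^sub>R 1"] by simp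
  ultimately show "norm a \<le> s + e"
    by (simp add: d_def)
qed

section \<open>Positivity of \<open>star x * x\<close>\<close>

lemma power_square_split: "(S::'b::monoid_mult) ^ (2 * m) = S ^ m * S ^ m"
  by (simp add: mult_2 power_add)

text \<open>All factors commute, so the left side is \<open>(1 + S) (1 - S^2) S^(2 m)\<close>, one
  step of a telescoping sum.\<close>

lemma conjugated_geometric_difference:
  fixes S :: "'b::cstar_algebra_1"
  shows "(S ^ m * (1 + S)) * (1 - S) * ((1 + S) * S ^ m)
    = (S ^ (2 * m) + S ^ (2 * m + 1)) - (S ^ (2 * Suc m) + S ^ (2 * Suc m + 1))"
proof -
  define P where "P = S ^ m"
  have c: "P * S = S * P" and c': "P * (S * z) = S * (P * z)" for z
    by (simp_all add: P_def power_commutes mult.assoc[symmetric])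
  have "S ^ (2 * m) = P * P" "S ^ (2 * m + 1) = S * (P * P)"
    "S ^ (2 * Suc m) = S * (S * (P * P))" "S ^ (2 * Suc m + 1) = S * (S * (S * (P * P)))"
    by (simp_all add: P_def power_square_split[symmetric] mult.assoc)
  then show ?thesis
    unfolding P_def[symmetric] by (simp add: algebra_simps c c')
qed

text \<open>
  Put \<open>S = 1 - x\<^sup>*x\<close> and \<open>S' = 1 - xx\<^sup>*\<close>. The element \<open>w = x(1 + S)S\<^sup>m\<close> satisfies
  \<open>w\<^sup>*w = (1 - S)(1 + S)\<^sup>2S\<^sup>2\<^sup>m\<close>, likewise for \<open>ww\<^sup>*\<close> and \<open>S'\<close>, and \<open>w\<^sup>*w + ww\<^sup>*\<close> is a sum of squares of
  self-adjoint elements. So the sum of \<open>S\<^sup>2\<^sup>m + S\<^sup>2\<^sup>m\<^sup>+\<^sup>1\<close> and the same expression in \<open>S'\<close> decreases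
  with \<open>m\<close>. Thus the powers of \<open>S\<close> stay bounded, which is only possible if \<open>\<parallel>S\<parallel> \<le> 1\<close>.
\<close>

lemma norm_one_minus_star_mult_le:
  fixes x :: "'b::cstar_algebra_1"
  assumes x: "norm x < 1"
  shows "norm (1 - star x * x) \<le> 1"
proof -
  define S where "S = 1 - star x * x"
  define S' where "S' = 1 - x * star x"
  have sa: "self_adjoint S" "self_adjoint S'"
    by (simp_all add: S_def S'_def self_adjoint_diff)
  \<comment> \<open>With \<open>k\<close> a root of \<open>T\<close> commuting with its powers, the
    odd power is the square of the self-adjoint \<open>T ^ m * k\<close>.\<close>
  have odd: "pos (T ^ (2 * m + 1))"
    if T: "T = 1 - c" "self_adjoint c" "norm c < 1" for T c :: 'b and m
  proof -
    obtain k where k: "self_adjoint k" "k * k = 1 - c" "\<And>z. z * c = c * z \<Longrightarrow> z * k = k * z"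
      using square_root_one_minus[OF T(2,3)] by blast
    have saT: "self_adjoint T"
      using T(1,2) by (simp add: self_adjoint_diff)
    have "T * c = c * T"
      by (simp add: T(1) algebra_simps)
    then have "T ^ m * c = c * T ^ m"
      using power_commuting_commutes[of T c m] by simp
    then have comm: "T ^ m * k = k * T ^ m"
      by (rule k(3))
    then have "(T ^ m * k) * (T ^ m * k) = T ^ m * T ^ m * (k * k)"
      by (metis mult.assoc)
    also have "\<dots> = T ^ (2 * m + 1)"
      by (simp only: k(2) T(1)[symmetric] power_square_split[symmetric] power_add power_one_right)
    finally show ?thesis
      using pos_square[OF self_adjoint_mult[OF self_adjoint_power[OF saT, of m] k(1) comm]] by simp
  qed
  have even: "pos (T ^ (2 * m))" if "self_adjoint T" for T :: 'b and m
    using pos_square[OF self_adjoint_power[OF that]] by (simp add: power_square_split)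
  have "norm (star x * x) < 1" "norm (x * star x) < 1"
    using x by (simp_all add: cstar_identity norm_mult_star abs_square_less_1)
  then have oddS: "pos (S ^ (2 * m + 1))" "pos (S' ^ (2 * m + 1))" for m
    using odd[OF S_def] odd[OF S'_def] by auto
  have sum_pos: "pos (star w * w + w * star w)" for w :: 'b
    by (rule mult_star_plus_star_mult[of w]) (simp add: pos_scaleR pos_add pos_square)
  \<comment> \<open>Moving \<open>x\<close> across the powers lets the same \<open>w\<close> be
    written with \<open>S\<close> for \<open>star w * w\<close> and with \<open>S'\<close> for
    \<open>w * star w\<close>.\<close>
  have inter: "x * S ^ m = S' ^ m * x" for m
  proof (induction m)
    case (Suc m)
    have "x * S = S' * x"
      by (simp add: S_def S'_def algebra_simps)
    then show ?case
      by (metis Suc mult.assoc power_Suc)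
  qed simp
  define G where "G m = (S ^ (2 * m) + S ^ (2 * m + 1)) + (S' ^ (2 * m) + S' ^ (2 * m + 1))" for m
  have step: "pos (G m - G (Suc m))" for m
  proof -
    define w where "w = x * ((1 + S) * S ^ m)"
    have w': "w = (S' ^ m * (1 + S')) * x"
    proof -
      have "w = x * S ^ m + x * S ^ Suc m"
        by (simp add: w_def algebra_simps)
      also have "\<dots> = (S' ^ m + S' ^ Suc m) * x"
        by (simp only: inter algebra_simps)
      finally show ?thesis
        by (simp add: algebra_simps power_commutes)
    qed
    have st: "star ((1 + T) * T ^ m) = T ^ m * (1 + T)" "star (T ^ m * (1 + T)) = (1 + T) * T ^ m"
      if "self_adjoint T" for T :: 'b
      using that self_adjoint_power[OF that, of m] by (simp_all add: self_adjoint_def star_mult star_add)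
    have "star w * w = (S ^ m * (1 + S)) * (1 - S) * ((1 + S) * S ^ m)"
      unfolding w_def star_mult[of x] st(1)[OF sa(1)] by (simp add: S_def mult.assoc)
    moreover have "w * star w = (S' ^ m * (1 + S')) * (1 - S') * ((1 + S') * S' ^ m)"
      unfolding w' star_mult[of _ x] st(2)[OF sa(2)] by (simp add: S'_def mult.assoc)
    ultimately have "star w * w + w * star w = G m - G (Suc m)"
      by (simp add: conjugated_geometric_difference G_def)
    then show ?thesis
      using sum_pos[of w] by simp
  qed
  \<comment> \<open>The constant is the number of units in
    \<open>G 0 = 4 - star x * x - x * star x\<close>.\<close>
  have "pos (4 *\<^sub>R 1 - G m)" for m
  proof (induction m)
    case 0
    have "4 *\<^sub>R (1::'b) = (1 + 1 + 1 + 1 :: real) *\<^sub>R 1"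
      by simp
    also have "\<dots> = 1 + 1 + 1 + 1"
      by (simp only: scaleR_left_distrib scaleR_one)
    finally have "4 *\<^sub>R 1 - G 0 = star x * x + x * star x"
      by (simp add: G_def S_def S'_def)
    then show ?case
      using sum_pos by simp
  next
    case (Suc m)
    then show ?case
      using pos_add[OF Suc step[of m]] by simp
  qed
  \<comment> \<open>Adding back three of the four positive summands of \<open>G m\<close> isolates
    \<open>S ^ (2 * m)\<close>.\<close>
  then have "pos ((4 *\<^sub>R 1 - G m) + S ^ (2 * m + 1) + S' ^ (2 * m) + S' ^ (2 * m + 1))" for m
    by (intro pos_add oddS even sa)
  then have "pos (4 *\<^sub>R 1 - S ^ (2 * m))" for m
    by (simp add: G_def algebra_simps)
  then have bound: "norm (S ^ (2 * m)) \<le> 4" for m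
    by (intro norm_le_if_pos even sa) auto
  have "norm S \<le> 1"
  proof (rule ccontr)
    assume "\<not> norm S \<le> 1"
    then obtain n where n: "4 < norm S ^ n"
      using real_arch_pow[of "norm S" 4] by auto
    \<comment> \<open>The exponent is a power of 2, where the norm of a power is the power of the
      norm, and it is even, so \<open>bound\<close> applies.\<close>
    have "norm S ^ n \<le> norm S ^ (2 ^ Suc n)"
      using \<open>\<not> norm S \<le> 1\<close> less_exp[of "Suc n"] by (intro power_increasing) auto
    also have "\<dots> \<le> 4"
      using bound[of "2 ^ n"] norm_power_self_adjoint[OF sa(1), of "Suc n"] by simp
    finally show False
      using n by simp
  qed
  then show ?thesis
    by (simp add: S_def)
qed

text \<open>After scaling to norm below 1, the bound on \<open>1 - star y * y\<close> makes 1 the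
  witness in \<open>pos\<close>.\<close>

lemma pos_star_mult: "pos (star x * x)" for x :: "'b::cstar_algebra_1"
proof -
  define t where "t = norm x + 1"
  define y where "y = (1 / t) *\<^sub>R x"
  have t: "0 < t"
    by (simp add: t_def add_nonneg_pos)
  have "norm y < 1"
    using t by (simp add: y_def) (simp add: t_def)
  then have "pos (star y * y)"
    using norm_one_minus_star_mult_le[of y] unfolding pos_def by (auto intro!: exI[of _ 1])
  then have "pos (t\<^sup>2 *\<^sub>R (star y * y))"
    by (rule pos_scaleR) simp
  then show ?thesis
    using t by (simp add: y_def power2_eq_square)
qed

text \<open>Conjugation by \<open>m\<close> preserves the order: with \<open>k\<close> a root of the
  shifted difference, \<open>star (k * m) * (k * m)\<close> is positive. Positive elements below a
  multiple of 1 then have their norm bounded by it.\<close>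

lemma norm_mult_square_le_conjugate:
  fixes a m z :: "'b::cstar_algebra_1"
  assumes z: "self_adjoint z" and za: "pos (z - star a * a)"
  shows "(norm (a * m))\<^sup>2 \<le> norm (star m * z * m)"
proof (rule field_le_epsilon)
  fix e :: real assume e: "0 < e"
  \<comment> \<open>The shift contributes \<open>d * (norm m)^2 \<le> e\<close> after conjugation;
    the added 1 keeps the denominator positive when \<open>m = 0\<close>.\<close>
  define d where "d = e / ((norm m)\<^sup>2 + 1)"
  have d: "0 < d"
    using e by (simp add: d_def add_nonneg_pos)
  obtain k where k: "self_adjoint k" "k * k = z - star a * a + d *\<^sub>R 1"
    using pos_square_root[OF za d] by blast
  define y where "y = star m * z * m + d *\<^sub>R (star m * m)"
  have y: "self_adjoint y"
    using z by (auto simp: y_def intro!: self_adjoint_add self_adjoint_conjugate self_adjoint_scaleR)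
  have "star (k * m) * (k * m) = star m * (k * k) * m"
    using k(1) by (simp add: self_adjoint_def star_mult mult.assoc)
  also have "\<dots> = y - star (a * m) * (a * m)"
    by (simp add: k(2) y_def star_mult algebra_simps)
  finally have "pos (y - star (a * m) * (a * m))"
    using pos_star_mult[of "k * m"] by simp
  from pos_add[OF pos_norm_minus[OF y order_refl] this]
  have "norm (star (a * m) * (a * m)) \<le> norm y"
    by (intro norm_le_if_pos pos_star_mult) auto
  also have "\<dots> \<le> norm (star m * z * m) + norm (d *\<^sub>R (star m * m))"
    unfolding y_def by (rule norm_triangle_ineq)
  also have "norm (d *\<^sub>R (star m * m)) = d * (norm m)\<^sup>2"
    using d by (simp add: cstar_identity)
  also have "\<dots> \<le> e"
    using e by (simp add: d_def divide_le_eq add_nonneg_pos)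
  finally show "(norm (a * m))\<^sup>2 \<le> norm (star m * z * m) + e"
    by (simp add: cstar_identity)
qed

section \<open>Approximate units\<close>

lemma geometric_sum_monoid:
  "(1 - S) * (\<Sum>j<N. S ^ j) = 1 - (S::'b::cstar_algebra_1) ^ N"
  by (induction N) (simp_all add: distrib_left left_diff_distrib)

text \<open>
  Averaging the powers of the contraction \<open>S = 1 - b\<^sup>2\<close>, \<open>b = x\<^sup>*x\<close>, yields a contraction \<open>m\<close> with
  \<open>b\<^sup>2m = (1 - S\<^sup>N) / N\<close>.
\<close>

lemma approximate_unit:
  fixes a :: "'b::cstar_algebra_1"
  assumes I: "subspace I" and mult: "\<And>x y. x \<in> I \<Longrightarrow> y \<in> I \<Longrightarrow> x * y \<in> I"
    and star: "\<And>x. x \<in> I \<Longrightarrow> star x \<in> I" and a: "a \<in> I" and e: "0 < e"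
  obtains m where "1 - m \<in> I" "norm m \<le> 1" "norm (a * m) < e"
proof -
  define t where "t = norm a + 1"
  define x where "x = (1 / t) *\<^sub>R a"
  define b where "b = star x * x"
  define S where "S = 1 - b * b"
  have t: "0 < t"
    by (simp add: t_def add_nonneg_pos)
  have xI: "x \<in> I"
    using I a by (simp add: x_def subspace_scale)
  have bI: "b \<in> I"
    using xI by (auto simp: b_def intro: mult star)
  have "norm x < 1"
    using t by (simp add: x_def) (simp add: t_def)
  then have b1: "norm b < 1"
    by (simp add: b_def cstar_identity abs_square_less_1)
  have bs: "star b = b"
    by (simp add: b_def star_mult star_star)
  have S1: "norm S \<le> 1"
    using norm_one_minus_star_mult_le[OF b1] by (simp add: bs S_def)
  have pw: "norm (S ^ j) \<le> 1" for j
  proof (induction j)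
    case (Suc j)
    show ?case
      using mult_mono[OF S1 Suc] norm_mult_ineq[of S "S ^ j"] by simp
  qed (simp add: norm_1_le)
  \<comment> \<open>The fourth power comes from applying \<open>le\<close> below twice:
    \<open>norm (x m)^4 \<le> norm (b m)^2 \<le> norm (b b m)\<close>, and the last norm is at most
    \<open>2 / N\<close>.\<close>
  obtain N where N: "2 / (e / t) ^ 4 < real N"
    using reals_Archimedean2 by blast
  have "0 < (e / t) ^ 4"
    using e t by simp
  then have N0: "0 < real N"
    using N by (smt (verit) divide_pos_pos)
  define m where "m = (1 / real N) *\<^sub>R (\<Sum>j<N. S ^ j)"
  have SI: "1 - S ^ j \<in> I" for j
  proof (induction j)
    case 0
    show ?case
      using I by (simp add: subspace_0)
  next
    case (Suc j)
    have "1 - S ^ Suc j = (1 - S ^ j) + b * b - b * b * (1 - S ^ j)"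
      by (simp add: S_def algebra_simps)
    moreover have "\<dots> \<in> I"
      by (rule subspace_diff[OF I subspace_add[OF I Suc mult[OF bI bI]] mult[OF mult[OF bI bI] Suc]])
    ultimately show ?case
      by (simp only:)
  qed
  have "norm (\<Sum>j<N. S ^ j) \<le> real N"
    using sum_norm_le[of "{..<N}" "\<lambda>j. S ^ j" "\<lambda>_. 1"] pw by simp
  then have m1: "norm m \<le> 1"
    using N0 by (simp add: m_def field_simps)
  have "1 - m = (1 / real N) *\<^sub>R (\<Sum>j<N. 1 - S ^ j)"
    using N0 by (simp add: m_def sum_subtractf scaleR_diff_right sum_constant_scaleR)
  then have mI: "1 - m \<in> I"
    using I SI by (auto intro!: subspace_scale subspace_sum)
  have "star S = S"
    using bs by (simp add: S_def star_diff star_mult)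
  then have ms: "star m = m"
    using self_adjoint_power[of S]
    by (simp add: m_def self_adjoint_def linear_sum[OF bounded_linear.linear[OF bounded_linear_star]])
  have "b * b * m = (1 / real N) *\<^sub>R (1 - S ^ N)"
    using geometric_sum_monoid[of S N] by (simp add: m_def S_def)
  moreover have "norm (1 - S ^ N) \<le> 2"
    using norm_triangle_ineq4[of 1 "S ^ N"] norm_1_le[where 'b = 'b] pw[of N] by simp
  ultimately have bbm: "norm (b * b * m) \<le> 2 / real N"
    using N0 by (simp add: divide_right_mono)
  \<comment> \<open>Since \<open>m\<close> is self-adjoint, the C*-identity puts one factor
    \<open>m\<close> on the left, where it is dropped as a contraction.\<close>
  have le: "(norm (y * m))\<^sup>2 \<le> norm (star y * y * m)" for y
  proof -
    have "(norm (y * m))\<^sup>2 = norm (m * (star y * y * m))"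
      using cstar_identity[of "y * m"] by (simp add: star_mult ms mult.assoc)
    also have "\<dots> \<le> norm m * norm (star y * y * m)"
      by (rule norm_mult_ineq)
    also have "\<dots> \<le> norm (star y * y * m)"
      using m1 by (simp add: mult_left_le_one_le)
    finally show ?thesis .
  qed
  have "norm (x * m) ^ 4 \<le> (norm (b * m))\<^sup>2"
    using power_mono[OF le[of x], of 2] by (simp add: b_def power_mult[symmetric])
  also have "\<dots> \<le> norm (b * b * m)"
    using le[of b] by (simp add: bs)
  also have "\<dots> < (e / t) ^ 4"
    using bbm N N0 \<open>0 < (e / t) ^ 4\<close> by (smt (verit) divide_less_eq mult.commute pos_divide_less_eq)
  finally have "norm (x * m) < e / t"
    using e t by (auto intro: power_less_imp_less_base)
  then have "norm (a * m) < e"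
    using t by (simp add: x_def field_simps)
  with mI m1 show thesis
    by (rule that)
qed

text \<open>To treat one more element \<open>a\<close>, apply the single-element case to
  \<open>a * m\<close>, which lies in \<open>I\<close> although \<open>m\<close> need not.
  Multiplying by the new contraction on the right keeps the earlier estimates.\<close>

lemma approximate_unit_finite:
  fixes F :: "'b::cstar_algebra_1 set"
  assumes I: "subspace I" and mult: "\<And>x y. x \<in> I \<Longrightarrow> y \<in> I \<Longrightarrow> x * y \<in> I"
    and star: "\<And>x. x \<in> I \<Longrightarrow> star x \<in> I" and F: "finite F" "F \<subseteq> I" and e: "0 < e"
  shows "\<exists>m. 1 - m \<in> I \<and> norm m \<le> 1 \<and> (\<forall>a\<in>F. norm (a * m) < e)"
  using F
proof (induction F)
  case empty
  show ?case
    using I by (intro exI[of _ 1]) (auto simp: norm_1_le subspace_0)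
next
  case (insert a F)
  then obtain m where m: "1 - m \<in> I" "norm m \<le> 1" "\<And>c. c \<in> F \<Longrightarrow> norm (c * m) < e"
    by auto
  have "a * m = a - a * (1 - m)"
    by (simp add: algebra_simps)
  then have "a * m \<in> I"
    using insert.prems m(1) I by (auto intro!: subspace_diff mult)
  then obtain n where n: "1 - n \<in> I" "norm n \<le> 1" "norm (a * m * n) < e"
    using approximate_unit[OF I mult star _ e] by metis
  have "1 - m * n = (1 - m) + (1 - n) - (1 - m) * (1 - n)"
    by (simp add: algebra_simps)
  moreover have "\<dots> \<in> I"
    by (rule subspace_diff[OF I subspace_add[OF I m(1) n(1)] mult[OF m(1) n(1)]])
  ultimately have "1 - m * n \<in> I"
    by (simp only:)
  moreover have le: "norm (c * n) \<le> norm c" for c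
    using norm_mult_ineq[of c n] mult_left_mono[OF n(2), of "norm c"] by simp
  then have "norm (m * n) \<le> 1"
    using m(2) order_trans by blast
  moreover have "norm (c * (m * n)) < e" if "c \<in> insert a F" for c
    using that n(3) m(3) le[of "c * m"] by (auto simp: mult.assoc intro: order.strict_trans1)
  ultimately show ?case
    by blast
qed

section \<open>Multipliers\<close>

text \<open>Adjointness for the inner product \<open>star x * y\<close>. The adjointable operators
  on the algebra as a module over itself form its multiplier algebra.\<close>

definition adjoint_pair :: "('a::cstar_algebra \<Rightarrow>\<^sub>L 'a) \<Rightarrow> ('a \<Rightarrow>\<^sub>L 'a) \<Rightarrow> bool"
  where "adjoint_pair T T' \<longleftrightarrow> (\<forall>x y. star (T x) * y = star x * T' y)"

lemma adjoint_pairD: "adjoint_pair T T' \<Longrightarrow> star (T x) * y = star x * T' y"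
  by (simp add: adjoint_pair_def)

lemma adjoint_pair_sym:
  assumes "adjoint_pair T T'"
  shows "adjoint_pair T' T"
  unfolding adjoint_pair_def
proof (intro allI)
  fix x y
  have "star (star (T y) * x) = star (star y * T' x)"
    using assms by (simp add: adjoint_pair_def)
  then show "star (T' x) * y = star x * T y"
    by (simp add: star_mult star_star)
qed

lemma eq_if_star_mult_eq:
  fixes u v :: "'a::cstar_algebra"
  assumes "\<And>x. star x * u = star x * v"
  shows "u = v"
proof -
  have "star (u - v) * (u - v) = 0"
    using assms[of "u - v"] by (simp add: right_diff_distrib)
  then show ?thesis
    by simp
qed

lemma adjoint_pair_unique:
  assumes "adjoint_pair T T1" "adjoint_pair T T2"
  shows "T1 = T2"
  by (rule blinfun_eqI, rule eq_if_star_mult_eq) (simp only: assms[THEN adjoint_pairD, symmetric])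

lemma The_adjoint_pair: "adjoint_pair T T' \<Longrightarrow> (THE T'. adjoint_pair T T') = T'"
  by (rule the_equality) (assumption, erule (1) adjoint_pair_unique)

text \<open>The bounded maps in use are a priori only real linear; an adjoint forces complex
  linearity, because the inner product is complex linear in its second argument.\<close>

lemma adjoint_pair_apply_scaleC:
  assumes "adjoint_pair T T'"
  shows "T (c *\<^sub>C x) = c *\<^sub>C T x"
  by (rule eq_if_star_mult_eq)
    (simp only: mult_scaleC_right adjoint_pairD[OF adjoint_pair_sym[OF assms], symmetric])

text \<open>The C*-identity at \<open>A x\<close> gives
  \<open>norm A ^ 2 \<le> norm (B A) \<le> norm B * norm A\<close>; the roles of \<open>A\<close>
  and \<open>B\<close> can be exchanged.\<close>

lemma adjoint_pair_norm:
  assumes "adjoint_pair T T'"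
  shows "norm T' = norm T" "norm (T' o\<^sub>L T) = (norm T)\<^sup>2"
proof -
  have *: "(norm A)\<^sup>2 \<le> norm (B o\<^sub>L A)" if "adjoint_pair A B" for A B :: "'a \<Rightarrow>\<^sub>L 'a"
  proof -
    have "norm (A x) \<le> sqrt (norm (B o\<^sub>L A)) * norm x" for x
    proof -
      have "(norm (A x))\<^sup>2 = norm (star x * (B o\<^sub>L A) x)"
        using cstar_identity[of "A x"] by (simp add: adjoint_pairD[OF that])
      also have "\<dots> \<le> norm x * (norm (B o\<^sub>L A) * norm x)"
        using norm_mult_ineq[of "star x" "(B o\<^sub>L A) x"] mult_left_mono[OF norm_blinfun[of "B o\<^sub>L A" x], of "norm x"]
        by simp
      also have "\<dots> = (sqrt (norm (B o\<^sub>L A)) * norm x)\<^sup>2"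
        by (simp add: power2_eq_square)
      finally show ?thesis
        by (rule power2_le_imp_le) simp
    qed
    then have "norm A \<le> sqrt (norm (B o\<^sub>L A))"
      by (intro norm_blinfun_bound) auto
    then show ?thesis
      by (metis norm_ge_zero power_mono real_sqrt_pow2)
  qed
  have **: "norm A \<le> norm B" if "adjoint_pair A B" for A B :: "'a \<Rightarrow>\<^sub>L 'a"
  proof (cases "A = 0")
    case False
    have "norm A * norm A \<le> norm B * norm A"
      using *[OF that] norm_blinfun_compose[of B A] by (simp add: power2_eq_square)
    then show ?thesis
      using False by simp
  qed simp
  show eq: "norm T' = norm T"
    using **[OF assms] **[OF adjoint_pair_sym[OF assms]] by simp
  show "norm (T' o\<^sub>L T) = (norm T)\<^sup>2"
    using *[OF assms] norm_blinfun_compose[of T' T] by (simp add: eq power2_eq_square)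
qed

lemma adjoint_pair_add:
  "adjoint_pair S S' \<Longrightarrow> adjoint_pair T T' \<Longrightarrow> adjoint_pair (S + T) (S' + T')"
  by (simp add: adjoint_pair_def blinfun.add_left star_add algebra_simps)

lemma adjoint_pair_diff:
  "adjoint_pair S S' \<Longrightarrow> adjoint_pair T T' \<Longrightarrow> adjoint_pair (S - T) (S' - T')"
  by (simp add: adjoint_pair_def blinfun.diff_left star_diff algebra_simps)

lemma adjoint_pair_compose:
  "adjoint_pair S S' \<Longrightarrow> adjoint_pair T T' \<Longrightarrow> adjoint_pair (S o\<^sub>L T) (T' o\<^sub>L S')"
  by (simp add: adjoint_pair_def)

lift_definition scaleC_blinfun ::
    "complex \<Rightarrow> ('a::cstar_algebra \<Rightarrow>\<^sub>L 'a) \<Rightarrow> ('a \<Rightarrow>\<^sub>L 'a)" is "\<lambda>c f x. c *\<^sub>C f x"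
proof -
  fix c and f :: "'a \<Rightarrow> 'a" assume f: "bounded_linear f"
  interpret f: bounded_linear f by fact
  have "bounded_linear ((*\<^sub>C) c :: 'a \<Rightarrow> 'a)"
    by (rule bounded_linear_intro[where K = "cmod c"])
      (simp_all add: scaleC_add_right scaleC_scaleR_right norm_scaleC)
  from bounded_linear_compose[OF this f] show "bounded_linear (\<lambda>x. c *\<^sub>C f x)" .
qed

lemma adjoint_pair_scaleC:
  "adjoint_pair T T' \<Longrightarrow> adjoint_pair (scaleC_blinfun c T) (scaleC_blinfun (cnj c) T')"
  by (simp add: adjoint_pair_def scaleC_blinfun.rep_eq star_scaleC mult_scaleC_left mult_scaleC_right)

lemma scaleC_blinfun_of_real: "scaleC_blinfun (complex_of_real r) T = r *\<^sub>R T"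
  by (rule blinfun_eqI) (simp add: scaleC_blinfun.rep_eq blinfun.scaleR_left)

lemma norm_scaleC_blinfun: "norm (scaleC_blinfun c T) = cmod c * norm T"
proof (cases "c = 0")
  case True
  then show ?thesis
    using scaleC_blinfun_of_real[of 0 T] by simp
next
  case False
  have le: "norm (scaleC_blinfun d S) \<le> cmod d * norm S" for d and S :: "'a \<Rightarrow>\<^sub>L 'a"
    by (rule norm_blinfun_bound)
      (auto simp: scaleC_blinfun.rep_eq norm_scaleC mult.assoc intro: mult_left_mono norm_blinfun)
  have "scaleC_blinfun (1 / c) (scaleC_blinfun c T) = T"
    using False by (intro blinfun_eqI) (simp add: scaleC_blinfun.rep_eq scaleC_scaleC)
  then have "norm T \<le> norm (scaleC_blinfun c T) / cmod c"
    using le[of "1 / c" "scaleC_blinfun c T"] by (simp add: norm_divide)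
  then show ?thesis
    using le[of c T] False by (simp add: field_simps)
qed

lemma adjoint_pair_scaleR: "adjoint_pair T T' \<Longrightarrow> adjoint_pair (r *\<^sub>R T) (r *\<^sub>R T')"
  using adjoint_pair_scaleC[of T T' "complex_of_real r"] by (simp add: scaleC_blinfun_of_real)

lemma adjoint_pair_id: "adjoint_pair id_blinfun id_blinfun"
  by (simp add: adjoint_pair_def)

text \<open>Taking adjoints is isometric, so the adjoints of a convergent sequence are Cauchy and
  their limit is an adjoint of the limit. This yields completeness of the multipliers.\<close>

lemma closed_adjointable: "closed {T. \<exists>T'. adjoint_pair T T'}"
  unfolding closed_sequential_limits
proof (intro allI impI)
  fix X and T :: "'a \<Rightarrow>\<^sub>L 'a"
  assume XT: "(\<forall>n. X n \<in> {T. \<exists>T'. adjoint_pair T T'}) \<and> X \<longlonglongrightarrow> T"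
  then obtain Y where Y: "\<And>n. adjoint_pair (X n) (Y n)"
    by simp metis
  have "norm (Y m - Y n) = norm (X m - X n)" for m n
    by (rule adjoint_pair_norm(1)[OF adjoint_pair_diff[OF Y Y]])
  moreover have "Cauchy X"
    using XT LIMSEQ_imp_Cauchy by blast
  ultimately have "Cauchy Y"
    by (simp add: Cauchy_iff)
  then obtain T' where T': "Y \<longlonglongrightarrow> T'"
    using Cauchy_convergent convergent_def by blast
  have "star (T x) * y = star x * T' y" for x y
  proof (rule LIMSEQ_unique)
    have "(\<lambda>n. X n x) \<longlonglongrightarrow> T x"
      using XT by (intro blinfun.tendsto tendsto_const) auto
    then show "(\<lambda>n. star (X n x) * y) \<longlonglongrightarrow> star (T x) * y"
      by (intro tendsto_mult tendsto_const bounded_linear.tendsto[OF bounded_linear_star])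
    show "(\<lambda>n. star (X n x) * y) \<longlonglongrightarrow> star x * T' y"
      unfolding adjoint_pairD[OF Y] by (intro tendsto_intros T')
  qed
  then show "T \<in> {T. \<exists>T'. adjoint_pair T T'}"
    by (auto simp: adjoint_pair_def)
qed

section \<open>The multiplier algebra as a unital C*-algebra\<close>

typedef (overloaded) 'a multiplier =
  "{T :: 'a::cstar_algebra \<Rightarrow>\<^sub>L 'a. \<exists>T'. adjoint_pair T T'}"
  morphisms blinfun_of_multiplier Multiplier
  using adjoint_pair_id by blast

setup_lifting type_definition_multiplier

instantiation multiplier :: (cstar_algebra) real_normed_vector
begin

lift_definition zero_multiplier :: "'a multiplier" is 0
  by (metis adjoint_pair_id adjoint_pair_scaleR scaleR_zero_left)

lift_definition plus_multiplier :: "'a multiplier \<Rightarrow> 'a multiplier \<Rightarrow> 'a multiplier" is "(+)"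
  using adjoint_pair_add by blast

lift_definition minus_multiplier :: "'a multiplier \<Rightarrow> 'a multiplier \<Rightarrow> 'a multiplier" is "(-)"
  using adjoint_pair_diff by blast

lift_definition uminus_multiplier :: "'a multiplier \<Rightarrow> 'a multiplier" is uminus
  by (metis adjoint_pair_scaleR scaleR_minus1_left)

lift_definition scaleR_multiplier :: "real \<Rightarrow> 'a multiplier \<Rightarrow> 'a multiplier" is scaleR
  using adjoint_pair_scaleR by blast

lift_definition norm_multiplier :: "'a multiplier \<Rightarrow> real" is norm .

definition dist_multiplier :: "'a multiplier \<Rightarrow> 'a multiplier \<Rightarrow> real"
  where "dist_multiplier x y = norm (x - y)"

definition sgn_multiplier :: "'a multiplier \<Rightarrow> 'a multiplier"
  where "sgn_multiplier x = scaleR (inverse (norm x)) x"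

definition uniformity_multiplier :: "('a multiplier \<times> 'a multiplier) filter"
  where "uniformity_multiplier = (INF e\<in>{0<..}. principal {(x, y). dist x y < e})"

definition open_multiplier :: "'a multiplier set \<Rightarrow> bool"
  where "open_multiplier S \<longleftrightarrow> (\<forall>x\<in>S. \<forall>\<^sub>F (x', y) in uniformity. x' = x \<longrightarrow> y \<in> S)"

instance
proof
  fix x y z :: "'a multiplier" and r s :: real and S :: "'a multiplier set"
  show "dist x y = norm (x - y)" "sgn x = scaleR (inverse (norm x)) x"
    "uniformity = (INF e\<in>{0<..}. principal {(x, y :: 'a multiplier). dist x y < e})"
    "open S \<longleftrightarrow> (\<forall>x\<in>S. \<forall>\<^sub>F (x', y) in uniformity. x' = x \<longrightarrow> y \<in> S)"
    by (simp_all add: dist_multiplier_def sgn_multiplier_def uniformity_multiplier_def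
        open_multiplier_def)
  show "norm (x + y) \<le> norm x + norm y"
    by transfer (rule norm_triangle_ineq)
  show "x + y + z = x + (y + z)" "x + y = y + x" "0 + x = x" "- x + x = 0" "x - y = x + - y"
    by (transfer, simp)+
  show "r *\<^sub>R (x + y) = r *\<^sub>R x + r *\<^sub>R y" "(r + s) *\<^sub>R x = r *\<^sub>R x + s *\<^sub>R x"
    "r *\<^sub>R s *\<^sub>R x = (r * s) *\<^sub>R x" "1 *\<^sub>R x = x"
    by (transfer, simp add: scaleR_add_right scaleR_add_left)+
  show "norm x = 0 \<longleftrightarrow> x = 0" "norm (r *\<^sub>R x) = \<bar>r\<bar> * norm x"
    by (transfer, simp)+
qed

end

lemma dist_blinfun_of_multiplier:
  "dist (blinfun_of_multiplier x) (blinfun_of_multiplier y) = dist x y"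
  by (simp add: dist_norm norm_multiplier.rep_eq minus_multiplier.rep_eq)

instance multiplier :: (cstar_algebra) banach
proof
  fix X :: "nat \<Rightarrow> 'a multiplier" assume "Cauchy X"
  then have "Cauchy (\<lambda>n. blinfun_of_multiplier (X n))"
    by (simp add: Cauchy_def dist_blinfun_of_multiplier)
  then obtain T where T: "(\<lambda>n. blinfun_of_multiplier (X n)) \<longlonglongrightarrow> T"
    using Cauchy_convergent convergent_def by blast
  have "T \<in> {T. \<exists>T'. adjoint_pair T T'}"
    using closed_sequentially[OF closed_adjointable _ T] blinfun_of_multiplier by blast
  then obtain L where "T = blinfun_of_multiplier L"
    using Multiplier_inverse[of T] by (intro that[of "Multiplier T"]) simp
  then have "X \<longlonglongrightarrow> L"
    using T by (simp add: lim_sequentially dist_blinfun_of_multiplier)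
  then show "convergent X"
    by (auto simp: convergent_def)
qed

instantiation multiplier :: (cstar_algebra) cstar_algebra_1
begin

lift_definition one_multiplier :: "'a multiplier" is id_blinfun
  using adjoint_pair_id by blast

lift_definition times_multiplier :: "'a multiplier \<Rightarrow> 'a multiplier \<Rightarrow> 'a multiplier" is "(o\<^sub>L)"
  using adjoint_pair_compose by blast

lift_definition scaleC_multiplier :: "complex \<Rightarrow> 'a multiplier \<Rightarrow> 'a multiplier" is scaleC_blinfun
  using adjoint_pair_scaleC by blast

text \<open>Adjoints are unique, so \<open>THE\<close> denotes the adjoint; it is adjointable in
  turn because the relation is symmetric.\<close>

lift_definition star_multiplier :: "'a multiplier \<Rightarrow> 'a multiplier"
  is "\<lambda>T. THE T'. adjoint_pair T T'"
proof -
  fix T :: "'a \<Rightarrow>\<^sub>L 'a" assume "\<exists>T'. adjoint_pair T T'"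
  then obtain T' where "adjoint_pair T T'" ..
  then show "\<exists>T'. adjoint_pair (THE T'. adjoint_pair T T') T'"
    using adjoint_pair_sym[of T T'] by (auto simp: The_adjoint_pair)
qed

lemma adjoint_pair_star:
  "adjoint_pair (blinfun_of_multiplier x) (blinfun_of_multiplier (star x))"
proof -
  obtain T' where "adjoint_pair (blinfun_of_multiplier x) T'"
    using blinfun_of_multiplier[of x] by blast
  then show ?thesis
    by (simp add: star_multiplier.rep_eq The_adjoint_pair)
qed

lemma star_multiplierI:
  assumes "adjoint_pair (blinfun_of_multiplier x) (blinfun_of_multiplier y)"
  shows "star x = y"
  using adjoint_pair_unique[OF adjoint_pair_star assms] by (simp add: blinfun_of_multiplier_inject)

instance
proof
  fix x y z :: "'a multiplier" and c d :: complex and r :: real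
  show "c *\<^sub>C (x + y) = c *\<^sub>C x + c *\<^sub>C y" "(c + d) *\<^sub>C x = c *\<^sub>C x + d *\<^sub>C x"
    "c *\<^sub>C d *\<^sub>C x = (c * d) *\<^sub>C x" "(c *\<^sub>C x) * y = c *\<^sub>C (x * y)"
    "x * y * z = x * (y * z)" "(x + y) * z = x * z + y * z" "x * (y + z) = x * y + x * z"
    "(r *\<^sub>R x) * y = r *\<^sub>R (x * y)" "x * (r *\<^sub>R y) = r *\<^sub>R (x * y)" "1 * x = x" "x * 1 = x"
    by (transfer, rule blinfun_eqI, simp add: scaleC_blinfun.rep_eq blinfun.bilinear_simps
        scaleC_add_right scaleC_add_left scaleC_scaleC)+
  show "r *\<^sub>R x = complex_of_real r *\<^sub>C x"
    by transfer (simp add: scaleC_blinfun_of_real)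
  show "norm (x * y) \<le> norm x * norm y"
    by transfer (rule norm_blinfun_compose)
  show "norm (c *\<^sub>C x) = cmod c * norm x"
    by transfer (rule norm_scaleC_blinfun)
  show "star (x + y) = star x + star y"
    by (rule star_multiplierI)
      (simp add: plus_multiplier.rep_eq adjoint_pair_add adjoint_pair_star)
  show "star (c *\<^sub>C x) = cnj c *\<^sub>C star x"
    by (rule star_multiplierI)
      (simp add: scaleC_multiplier.rep_eq adjoint_pair_scaleC adjoint_pair_star)
  show "star (x * y) = star y * star x"
    by (rule star_multiplierI)
      (simp add: times_multiplier.rep_eq adjoint_pair_compose adjoint_pair_star)
  show "star (star x) = x"
    by (rule star_multiplierI) (simp add: adjoint_pair_sym adjoint_pair_star)
  show "norm (star x * x) = (norm x)\<^sup>2"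
    using adjoint_pair_norm(2)[OF adjoint_pair_star]
    by (simp add: norm_multiplier.rep_eq times_multiplier.rep_eq)
  show "x * (c *\<^sub>C y) = c *\<^sub>C (x * y)"
    by transfer (auto intro!: blinfun_eqI simp: scaleC_blinfun.rep_eq adjoint_pair_apply_scaleC)
qed

end

section \<open>Embedding the algebra into its multipliers\<close>

lemma adjoint_pair_mult: "adjoint_pair (blinfun_mult_right a) (blinfun_mult_right (star a))"
  by (simp add: adjoint_pair_def star_mult mult.assoc)

text \<open>\<open>blinfun_mult_right a\<close> maps \<open>x\<close> to \<open>a * x\<close>, so
  this is the canonical embedding.\<close>

lift_definition left_mult :: "'a::cstar_algebra \<Rightarrow> 'a multiplier" is blinfun_mult_right
  using adjoint_pair_mult by blast

lemma left_mult_add: "left_mult (a + b) = left_mult a + left_mult b"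
  and left_mult_diff: "left_mult (a - b) = left_mult a - left_mult b"
  and left_mult_uminus: "left_mult (- a) = - left_mult a"
  and left_mult_scaleR: "left_mult (r *\<^sub>R a) = r *\<^sub>R left_mult a"
  and left_mult_mult: "left_mult (a * b) = left_mult a * left_mult b"
  by (transfer, rule blinfun_eqI, simp add: blinfun.add_left blinfun.diff_left blinfun.minus_left
      blinfun.scaleR_left distrib_right left_diff_distrib mult.assoc)+

lemma star_left_mult: "star (left_mult a) = left_mult (star a)"
  by (rule star_multiplierI) (simp add: left_mult.rep_eq adjoint_pair_mult)

text \<open>The lower bound comes from evaluating at \<open>star a\<close>, where
  \<open>norm (a * star a) = (norm a)^2\<close>.\<close>

lemma norm_left_mult: "norm (left_mult a) = norm a"
proof (rule antisym)
  show "norm (left_mult a) \<le> norm a"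
    unfolding norm_multiplier.rep_eq left_mult.rep_eq
    by (rule norm_blinfun_bound) (simp_all add: norm_mult_ineq)
  show "norm a \<le> norm (left_mult a)"
  proof (cases "a = 0")
    case False
    have "norm a * norm a \<le> norm (left_mult a) * norm a"
      using norm_blinfun[of "blinfun_mult_right a" "star a"]
      unfolding norm_multiplier.rep_eq left_mult.rep_eq blinfun_mult_right.rep_eq norm_mult_star
      by (simp add: power2_eq_square)
    then show ?thesis
      using False by simp
  qed simp
qed

lemma subspace_range_left_mult: "subspace (range left_mult)"
  unfolding subspace_def
proof (intro conjI ballI allI)
  show "0 \<in> range left_mult"
    by (metis diff_self left_mult_diff rangeI)
qed (auto simp flip: left_mult_add left_mult_scaleR)

lemma norm_diff_mult_eq: "norm (a - a * u) = norm (left_mult a * (1 - left_mult u))"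
  using norm_left_mult[of "a - a * u"]
  by (simp add: left_mult_diff left_mult_mult right_diff_distrib)

lemma approximate_unit_algebra:
  fixes F :: "'a::cstar_algebra set"
  assumes "finite F" "0 < e"
  shows "\<exists>u. norm (1 - left_mult u) \<le> 1 \<and> (\<forall>a\<in>F. norm (a - a * u) < e)"
proof -
  have "\<exists>m. 1 - m \<in> range left_mult \<and> norm m \<le> 1 \<and> (\<forall>a\<in>left_mult ` F. norm (a * m) < e)"
    using assms
    by (intro approximate_unit_finite subspace_range_left_mult)
      (auto simp: star_left_mult simp flip: left_mult_mult)
  then obtain m u where m: "norm m \<le> 1" "\<And>a. a \<in> F \<Longrightarrow> norm (left_mult a * m) < e"
    and "1 - m = left_mult u"
    by (auto simp: image_iff)
  then have "m = 1 - left_mult u"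
    by (simp add: algebra_simps)
  then show ?thesis
    using m by (auto simp: norm_diff_mult_eq)
qed

section \<open>States and strictly positive elements\<close>

text \<open>
  \<open>p\<close> bounds \<open>2 Re x\<close> from above modulo multiples of \<open>h\<close>. A linear functional below \<open>p\<close> is
  positive, vanishes at \<open>h\<close> and, by the choice of \<open>e\<close>, can be made positive at \<open>a\<^sup>*a\<close>.
\<close>

lemma state_vanishing:
  fixes a h :: "'a::cstar_algebra"
  assumes h: "positive h" and e: "0 < e"
    and e_le: "\<And>c. 0 \<le> c \<Longrightarrow> \<not> pos (e *\<^sub>R 1 + c *\<^sub>R left_mult h - left_mult (star a * a))"
  obtains \<phi> where "is_state \<phi>" "\<phi> h = 0"
proof -
  \<comment> \<open>The condition \<open>0 \<le> t\<close> bounds each set below, and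
    \<open>t = 2 * norm x\<close> with \<open>c = 0\<close> shows that it is nonempty, so the
    infimum is meaningful.\<close>
  define T where "T x = {t. 0 \<le> t \<and> (\<exists>c\<ge>0. pos (t *\<^sub>R 1 + c *\<^sub>R left_mult h - left_mult (x + star x)))}"
    for x :: 'a
  define p where "p x = Inf (T x)" for x
  have sah: "star h = h"
    using h by (auto simp: positive_def star_mult star_star)
  have posh: "pos (left_mult (star x * x))" for x :: 'a
    using pos_star_mult[of "left_mult x"] by (simp add: left_mult_mult star_left_mult)
  have TI: "t \<in> T x" if "0 \<le> t" "0 \<le> c" "pos (t *\<^sub>R 1 + c *\<^sub>R left_mult h - left_mult (x + star x))"
    for t c x
    using that by (auto simp: T_def)
  have norm_T: "2 * norm x \<in> T x" for x
  proof (rule TI[of _ 0])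
    have "self_adjoint (left_mult (x + star x))"
      by (simp add: self_adjoint_def star_left_mult star_add star_star add.commute)
    moreover have "norm (left_mult (x + star x)) \<le> 2 * norm x"
      using norm_triangle_ineq[of x "star x"] by (simp add: norm_left_mult)
    ultimately show "pos ((2 * norm x) *\<^sub>R 1 + 0 *\<^sub>R left_mult h - left_mult (x + star x))"
      using pos_norm_minus by simp
  qed auto
  have bdd: "bdd_below (T x)" for x
    by (intro bdd_belowI[of _ 0]) (simp add: T_def)
  have p_le: "p x \<le> t" if "t \<in> T x" for t x
    unfolding p_def using that bdd by (rule cInf_lower)
  have le_p: "c \<le> p x" if "\<And>t. t \<in> T x \<Longrightarrow> c \<le> t" for c x
    unfolding p_def using norm_T[of x] that by (intro cInf_greatest) auto
  have T_add: "s + t \<in> T (x + y)" if st: "s \<in> T x" "t \<in> T y" for s t x y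
  proof -
    obtain c d where cd: "0 \<le> c" "0 \<le> d"
      "pos (s *\<^sub>R 1 + c *\<^sub>R left_mult h - left_mult (x + star x))"
      "pos (t *\<^sub>R 1 + d *\<^sub>R left_mult h - left_mult (y + star y))"
      using st by (auto simp: T_def)
    have "(s + t) *\<^sub>R 1 + (c + d) *\<^sub>R left_mult h - left_mult (x + y + star (x + y))
      = (s *\<^sub>R 1 + c *\<^sub>R left_mult h - left_mult (x + star x))
        + (t *\<^sub>R 1 + d *\<^sub>R left_mult h - left_mult (y + star y))"
      by (simp add: left_mult_add star_add scaleR_add_left)
    then show ?thesis
      using st cd pos_add[OF cd(3,4)] by (intro TI[of _ "c + d"]) (auto simp: T_def)
  qed
  have T_scale: "r * t \<in> T (r *\<^sub>R x)" if r: "0 < r" and t: "t \<in> T x" for r t x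
  proof -
    obtain c where c: "0 \<le> c" "pos (t *\<^sub>R 1 + c *\<^sub>R left_mult h - left_mult (x + star x))"
      using t by (auto simp: T_def)
    have "(r * t) *\<^sub>R 1 + (r * c) *\<^sub>R left_mult h - left_mult (r *\<^sub>R x + star (r *\<^sub>R x))
      = r *\<^sub>R (t *\<^sub>R 1 + c *\<^sub>R left_mult h - left_mult (x + star x))"
      by (simp add: left_mult_add left_mult_scaleR scaleR_add_right scaleR_diff_right)
    then show ?thesis
      using r t c pos_scaleR[OF c(2), of r] by (intro TI[of _ "r * c"]) (auto simp: T_def)
  qed
  have "sublinear p"
    unfolding sublinear_def
  proof (intro conjI allI impI)
    fix x y
    have "p (x + y) - t \<le> p x" if "t \<in> T y" for t
    proof (rule le_p)
      fix s assume "s \<in> T x"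
      then show "p (x + y) - t \<le> s"
        using p_le[OF T_add[OF _ that]] by (simp add: algebra_simps)
    qed
    then have "p (x + y) - p x \<le> t" if "t \<in> T y" for t
      using that by (simp add: algebra_simps)
    then show "p (x + y) \<le> p x + p y"
      using le_p[of y "p (x + y) - p x"] by simp
  next
    fix r :: real and x assume r: "0 < r"
    have "p (r *\<^sub>R x) / r \<le> p x"
    proof (rule le_p)
      fix t assume "t \<in> T x"
      then show "p (r *\<^sub>R x) / r \<le> t"
        using p_le[OF T_scale[OF r, of t x]] r by (simp add: pos_divide_le_eq mult.commute)
    qed
    then show "p (r *\<^sub>R x) \<le> r * p x"
      using r by (simp add: field_simps)
  qed
  then obtain f where f: "linear f" "\<And>x. f x \<le> p x" "f (star a * a) = p (star a * a)"
    using Hahn_Banach_support by blast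
  note f_simps = linear_add[OF f(1)] linear_scale[OF f(1)] linear_neg[OF f(1)] linear_0[OF f(1)]
  have f_le0: "f x \<le> 0" if "0 \<in> T x" for x
    using f(2)[of x] p_le[OF that] by linarith
  have fpos: "0 \<le> f (star x * x)" for x
  proof -
    have "pos (left_mult (star x * x) + left_mult (star x * x))"
      by (intro pos_add posh)
    then have "0 \<in> T (- (star x * x))"
      by (intro TI[of _ 0])
        (simp_all add: star_mult star_star left_mult_diff left_mult_uminus)
    then show ?thesis
      using f_le0[of "- (star x * x)"] by (simp add: f_simps)
  qed
  \<comment> \<open>Here \<open>x + star x = 0\<close>, so \<open>t = c = 0\<close> is admissible
    for both \<open>x\<close> and \<open>- x\<close>.\<close>
  have f_skew: "f x = 0" if "star x = - x" for x
  proof -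
    have "left_mult (0::'a) = 0"
      using left_mult_diff[of 0 "0::'a"] by simp
    then have "0 \<in> T x" "0 \<in> T (- x)"
      using that by (auto intro!: TI[of _ 0])
    then show ?thesis
      using f_le0[of x] f_le0[of "- x"] by (simp add: f_simps)
  qed
  have fh: "f h = 0"
  proof -
    \<comment> \<open>The multiple 2 matches \<open>h + star h = 2 h\<close>.\<close>
    have "0 \<in> T h"
      by (rule TI[of _ 2]) (simp_all add: sah left_mult_add scaleR_2)
    moreover have "0 \<le> f h"
      using h fpos by (auto simp: positive_def)
    ultimately show ?thesis
      using f_le0[of h] by simp
  qed
  have fa: "0 < f (star a * a)"
  proof -
    \<comment> \<open>Otherwise halving the witness for \<open>t\<close> and adding
      \<open>(e - t / 2) *\<^sub>R 1\<close> contradicts \<open>e_le\<close> at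
      \<open>c / 2\<close>.\<close>
    have "2 * e \<le> t" if t: "t \<in> T (star a * a)" for t
    proof (rule ccontr)
      assume "\<not> 2 * e \<le> t"
      obtain c where c: "0 \<le> c"
        "pos (t *\<^sub>R 1 + c *\<^sub>R left_mult h - left_mult (star a * a + star (star a * a)))"
        using t unfolding T_def by blast
      have "pos ((e - t / 2) *\<^sub>R 1 + (1 / 2) *\<^sub>R (t *\<^sub>R 1 + c *\<^sub>R left_mult h
          - left_mult (star a * a + star (star a * a))))"
        using \<open>\<not> 2 * e \<le> t\<close> by (intro pos_add pos_scaleR pos_1 c(2)) auto
      also have "left_mult (star a * a + star (star a * a)) = 2 *\<^sub>R left_mult (star a * a)"
        by (simp add: star_mult star_star left_mult_add scaleR_2)
      also have "(e - t / 2) *\<^sub>R 1 + (1 / 2) *\<^sub>R (t *\<^sub>R 1 + c *\<^sub>R left_mult h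
          - 2 *\<^sub>R left_mult (star a * a))
          = e *\<^sub>R 1 + (c / 2) *\<^sub>R left_mult h - left_mult (star a * a)"
        by (simp add: scaleR_diff_right scaleR_diff_left scaleR_add_right)
      finally show False
        using e_le[of "c / 2"] c(1) by simp
    qed
    then show ?thesis
      using le_p[of "star a * a" "2 * e"] e by (simp add: f(3))
  qed
  have fbound: "\<bar>f x\<bar> \<le> 2 * norm x" for x
    using f(2)[of x] f(2)[of "- x"] p_le[OF norm_T[of x]] p_le[OF norm_T[of "- x"]]
    by (simp add: f_simps)
  \<comment> \<open>The usual complexification of a real functional. It is real on
    \<open>star x * x\<close> because \<open>\<i> *\<^sub>C (star x * x)\<close> is
    skew-adjoint.\<close>
  define \<phi> where "\<phi> x = Complex (f x) (- f (\<i> *\<^sub>C x))" for x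
  have bl: "bounded_linear \<phi>"
  proof (rule bounded_linear_intro[where K = 4])
    show "\<phi> (x + y) = \<phi> x + \<phi> y" for x y
      by (simp add: \<phi>_def scaleC_add_right f_simps complex_eq_iff)
    show "\<phi> (r *\<^sub>R x) = r *\<^sub>R \<phi> x" for r x
      by (simp add: \<phi>_def scaleC_scaleR_right f_simps complex_eq_iff)
    show "cmod (\<phi> x) \<le> norm x * 4" for x
      using cmod_le[of "\<phi> x"] fbound[of x] fbound[of "\<i> *\<^sub>C x"]
      by (simp add: \<phi>_def norm_scaleC)
  qed
  have lin: "\<phi> (c *\<^sub>C x) = c * \<phi> x" for c x
  proof -
    have "f (c *\<^sub>C y) = Re c * f y + Im c * f (\<i> *\<^sub>C y)" for y
      by (simp add: scaleC_Complex[of c] f_simps)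
    moreover have "\<i> *\<^sub>C c *\<^sub>C x = c *\<^sub>C \<i> *\<^sub>C x"
      by (simp add: scaleC_scaleC mult.commute)
    ultimately show ?thesis
      by (simp add: \<phi>_def f_simps complex_eq_iff)
  qed
  have im: "f (\<i> *\<^sub>C (star x * x)) = 0" for x
    by (rule f_skew) (simp add: star_mult star_star)
  have \<phi>_pos: "\<phi> (star x * x) = complex_of_real (f (star x * x))" for x
    by (simp add: \<phi>_def im complex_eq_iff)
  have "\<phi> (star a * a) \<noteq> 0"
    using fa by (simp add: \<phi>_pos)
  then have "onorm \<phi> \<noteq> 0"
    using onorm_eq_0[OF bl] by auto
  then have N: "0 < onorm \<phi>"
    using onorm_pos_le[OF bl] by simp
  define \<psi> where "\<psi> x = (1 / onorm \<phi>) *\<^sub>R \<phi> x" for x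
  have "bounded_linear \<psi>"
    unfolding \<psi>_def by (rule bounded_linear_scaleR_right[THEN bounded_linear_compose, OF bl])
  moreover have "onorm \<psi> = 1"
    unfolding \<psi>_def using N by (simp add: onorm_scaleR[OF bl])
  moreover have "\<psi> (c *\<^sub>C x) = c * \<psi> x" for c x
    by (simp add: \<psi>_def lin)
  moreover have "\<psi> (star x * x) = complex_of_real (f (star x * x) / onorm \<phi>)" for x
    by (simp add: \<psi>_def \<phi>_pos scaleR_conv_of_real)
  ultimately have "is_state \<psi>"
    using N fpos unfolding is_state_def by simp
  moreover have "\<psi> h = 0"
    using h fh by (auto simp: \<psi>_def \<phi>_pos positive_def)
  ultimately show thesis
    by (rule that)
qed

section \<open>Sequential approximate units\<close>

lemma strictly_positive_approximate_unit:
  fixes h :: "'a::cstar_algebra"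
  assumes h: "strictly_positive h"
  shows "\<exists>u :: nat \<Rightarrow> 'a. \<forall>a. (\<lambda>n. a * u n) \<longlonglongrightarrow> a"
proof -
  obtain u where u: "norm (1 - left_mult (u n)) \<le> 1" "norm (h - h * u n) < 1 / real (Suc n)" for n
    using approximate_unit_algebra[of "{h}" "1 / real (Suc n)" for n] by simp metis
  have lim: "(\<lambda>n. norm (h - h * u n)) \<longlonglongrightarrow> 0"
    by (rule tendsto_sandwich[OF _ _ tendsto_const LIMSEQ_inverse_real_of_nat])
      (auto intro!: always_eventually less_imp_le u(2) simp: inverse_eq_divide simp del: of_nat_Suc)
  have "(\<lambda>n. a - a * u n) \<longlonglongrightarrow> 0" for a
  proof (rule LIMSEQ_I)
    fix r :: real assume r: "0 < r"
    \<comment> \<open>The square of the target error is shared equally between the term with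
      \<open>e\<close> and the term with \<open>c * norm (h - h * u n)\<close>.\<close>
    define e where "e = r\<^sup>2 / 2"
    have e: "0 < e"
      using r by (simp add: e_def)
    \<comment> \<open>If no \<open>c\<close> worked, \<open>state_vanishing\<close> would give a
      state with value 0 at \<open>h\<close>, against strict positivity.\<close>
    obtain c where c: "0 \<le> c" "pos (e *\<^sub>R 1 + c *\<^sub>R left_mult h - left_mult (star a * a))"
      using state_vanishing[of h e a] h e unfolding strictly_positive_def
      by (metis less_irrefl zero_complex.sel(1))
    have "(\<lambda>n. c * norm (h - h * u n)) \<longlonglongrightarrow> 0"
      using tendsto_mult_left[OF lim, of c] by simp
    then have "\<forall>\<^sub>F n in sequentially. c * norm (h - h * u n) < e"
      using e by (rule order_tendstoD(2))
    then obtain N where N: "\<And>n. N \<le> n \<Longrightarrow> c * norm (h - h * u n) < e"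
      by (auto simp: eventually_sequentially)
    have "norm (a - a * u n) < r" if n: "N \<le> n" for n
    proof -
      define m where "m = 1 - left_mult (u n)"
      define z where "z = e *\<^sub>R 1 + c *\<^sub>R left_mult h"
      have m: "norm m \<le> 1"
        using u(1) by (simp add: m_def)
      have "positive h"
        using h by (simp add: strictly_positive_def)
      then have "star h = h"
        by (auto simp: positive_def star_mult star_star)
      then have z: "self_adjoint z"
        by (simp add: z_def self_adjoint_def star_add star_left_mult)
      have "(norm (left_mult a * m))\<^sup>2 \<le> norm (star m * z * m)"
        using c(2) by (intro norm_mult_square_le_conjugate z)
          (simp add: z_def star_left_mult left_mult_mult)
      also have "star m * z * m = e *\<^sub>R (star m * m) + c *\<^sub>R (star m * (left_mult h * m))"
        by (simp add: z_def algebra_simps)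
      also have "norm \<dots> \<le> e * (norm m)\<^sup>2 + c * (norm m * norm (left_mult h * m))"
        using e c(1) norm_mult_ineq[of "star m" "left_mult h * m"]
        by (intro norm_triangle_le add_mono) (simp_all add: cstar_identity mult_left_mono)
      also have "\<dots> \<le> e * 1 + c * (1 * norm (left_mult h * m))"
        using e c(1) m by (intro add_mono mult_left_mono mult_right_mono) (simp_all add: power_le_one)
      also have "\<dots> < e + e"
        using N[OF n] by (simp add: m_def norm_diff_mult_eq)
      also have "\<dots> = r\<^sup>2"
        by (simp add: e_def)
      finally show ?thesis
        using r by (simp add: m_def norm_diff_mult_eq power_less_imp_less_base)
    qed
    then show "\<exists>N. \<forall>n\<ge>N. norm (a - a * u n - 0) < r"
      by auto
  qed
  then have "(\<lambda>n. a - (a - a * u n)) \<longlonglongrightarrow> a - 0" for a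
    by (intro tendsto_diff tendsto_const)
  then show ?thesis
    by auto
qed

text \<open>The \<open>n\<close>-th element handles the points \<open>d 0\<close> to
  \<open>d n\<close> of a dense sequence up to \<open>1 / (n + 1)\<close>. The uniform bound on
  \<open>1 - left_mult (u n)\<close> carries convergence from the dense set to every
  \<open>a\<close>.\<close>

lemma separable_approximate_unit:
  assumes "separable TYPE('a::cstar_algebra)"
  shows "\<exists>u :: nat \<Rightarrow> 'a. \<forall>a. (\<lambda>n. a * u n) \<longlonglongrightarrow> a"
proof -
  obtain D :: "'a set" where D: "countable D" "closure D = UNIV"
    using assms by (auto simp: separable_def)
  then have "D \<noteq> {}"
    by auto
  define d where "d = from_nat_into D"
  have rd: "range d = D"
    using D(1) \<open>D \<noteq> {}\<close> by (simp add: d_def range_from_nat_into)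
  have "\<exists>u. norm (1 - left_mult u) \<le> 1 \<and> (\<forall>i\<le>n. norm (d i - d i * u) < 1 / real (Suc n))" for n
    using approximate_unit_algebra[of "d ` {..n}" "1 / real (Suc n)"] by auto
  then obtain u where u: "norm (1 - left_mult (u n)) \<le> 1"
    "i \<le> n \<Longrightarrow> norm (d i - d i * u n) < 1 / real (Suc n)" for n i
    by metis
  have "(\<lambda>n. a * u n) \<longlonglongrightarrow> a" for a
  proof (rule LIMSEQ_I)
    fix r :: real assume r: "0 < r"
    have "a \<in> closure D"
      by (simp add: D(2))
    then obtain b where "b \<in> D" "dist b a < r / 2"
      using r unfolding closure_approachable by (metis half_gt_zero)
    then obtain i where i: "norm (a - d i) < r / 2"
      using rd by (metis dist_commute dist_norm imageE)
    obtain N :: nat where N: "2 / r < real N"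
      using reals_Archimedean2 by blast
    have "norm (a * u n - a) < r" if n: "max i N \<le> n" for n
    proof -
      have "norm (left_mult (a - d i) * (1 - left_mult (u n)))
          \<le> norm (a - d i) * norm (1 - left_mult (u n))"
        using norm_mult_ineq[of "left_mult (a - d i)"] by (simp only: norm_left_mult)
      also have "\<dots> \<le> norm (a - d i) * 1"
        by (intro mult_left_mono u(1)) simp
      finally have 1: "norm ((a - d i) - (a - d i) * u n) < r / 2"
        using i by (simp add: norm_diff_mult_eq)
      have "2 / r < real (Suc n)"
        using N n by simp
      then have "1 / real (Suc n) < r / 2"
        using r by (simp add: field_simps)
      then have 2: "norm (d i - d i * u n) < r / 2"
        using u(2)[of i n] n by simp
      have eq: "a - a * u n = ((a - d i) - (a - d i) * u n) + (d i - d i * u n)"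
        by (simp add: algebra_simps)
      have "norm (a - a * u n) < r"
        unfolding eq
        using norm_triangle_ineq[of "(a - d i) - (a - d i) * u n" "d i - d i * u n"] 1 2 by linarith
      then show ?thesis
        by (simp add: norm_minus_commute)
    qed
    then show "\<exists>N. \<forall>n\<ge>N. norm (a * u n - a) < r"
      by blast
  qed
  then show ?thesis
    by blast
qed

section \<open>The equivalences\<close>

lemma module_Schur_imp_mBS2:
  assumes "module_Schur ip"
  shows "mBS2 ip"
  unfolding mBS2_def
proof (intro allI impI)
  fix x assume "tau_convergent ip x"
  then obtain L where "x \<longlonglongrightarrow> L"
    using assms by (auto simp: module_Schur_def convergent_def)
  then show "\<exists>r. strict_mono r \<and> convergent (\<lambda>k. (1 / real (Suc k)) *\<^sub>R (\<Sum>i\<le>k. x (r i)))"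
    by (intro exI[of _ id])
      (auto simp: strict_mono_id convergent_def simp del: of_nat_Suc intro: tendsto_arithmetic_mean)
qed

lemma unital_imp_module_Schur:
  assumes "unital TYPE('a::cstar_algebra)"
  shows "module_Schur (self_ip :: 'a \<Rightarrow> 'a \<Rightarrow> 'a)"
proof -
  obtain e :: 'a where e: "\<And>a. e * a = a"
    using assms by (auto simp: unital_def)
  show ?thesis
    unfolding module_Schur_def
  proof (intro allI impI)
    fix x :: "nat \<Rightarrow> 'a" assume "tau_convergent self_ip x"
    \<comment> \<open>Testing against \<open>star e\<close> gives \<open>e * x n\<close> directly,
      without first showing that \<open>e\<close> is self-adjoint.\<close>
    then have "convergent (\<lambda>n. self_ip (star e) (x n))"
      by (simp add: tau_convergent_def)
    then show "convergent x"
      by (simp add: self_ip_def star_star e)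
  qed
qed

lemma mBS2_imp_unital:
  fixes u :: "nat \<Rightarrow> 'a::cstar_algebra"
  assumes mBS2: "mBS2 (self_ip :: 'a \<Rightarrow> 'a \<Rightarrow> 'a)"
    and u: "\<And>a. (\<lambda>n. a * u n) \<longlonglongrightarrow> a"
  shows "unital TYPE('a)"
proof -
  have "tau_convergent self_ip u"
    using u by (auto simp: tau_convergent_def self_ip_def convergent_def)
  then obtain r e where r: "strict_mono r"
    and e: "(\<lambda>k. (1 / real (Suc k)) *\<^sub>R (\<Sum>i\<le>k. u (r i))) \<longlonglongrightarrow> e"
    using mBS2 unfolding mBS2_def convergent_def by blast
  \<comment> \<open>The means of \<open>a * u (r i)\<close> have two limits: \<open>a * e\<close> by
    continuity of multiplication, and \<open>a\<close> by averaging a subsequence of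
    \<open>a * u n\<close>.\<close>
  have right: "a * e = a" for a
  proof (rule LIMSEQ_unique)
    show "(\<lambda>k. a * ((1 / real (Suc k)) *\<^sub>R (\<Sum>i\<le>k. u (r i)))) \<longlonglongrightarrow> a * e"
      by (intro tendsto_mult tendsto_const e)
    have "(\<lambda>i. a * u (r i)) \<longlonglongrightarrow> a"
      using LIMSEQ_subseq_LIMSEQ[OF u[of a] r] by (simp add: o_def)
    from tendsto_arithmetic_mean[OF this]
    show "(\<lambda>k. a * ((1 / real (Suc k)) *\<^sub>R (\<Sum>i\<le>k. u (r i)))) \<longlonglongrightarrow> a"
      by (simp add: sum_distrib_left)
  qed
  \<comment> \<open>\<open>star e * e = star e\<close>, and the left side is self-adjoint. Taking
    adjoints then turns the right unit into a left unit.\<close>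
  have "star e = e"
    using right[of "star e"] by (metis star_mult star_star)
  then have "e * a = a" for a
    using right[of "star a"] by (metis star_mult star_star)
  with right show ?thesis
    by (auto simp: unital_def)
qed

theorem theorem5p5:
  assumes "(\<exists>h::'a::cstar_algebra. strictly_positive h) \<or> separable TYPE('a)"
  shows "(mBS2 (self_ip :: 'a \<Rightarrow> 'a \<Rightarrow> 'a) \<longleftrightarrow> unital TYPE('a)) \<and>
         (unital TYPE('a) \<longleftrightarrow> module_Schur (self_ip :: 'a \<Rightarrow> 'a \<Rightarrow> 'a))"
proof -
  obtain u :: "nat \<Rightarrow> 'a" where "\<And>a. (\<lambda>n. a * u n) \<longlonglongrightarrow> a"
    using assms strictly_positive_approximate_unit separable_approximate_unit by metis
  then show ?thesis
    using mBS2_imp_unital[of u] unital_imp_module_Schur module_Schur_imp_mBS2 by blast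
qed

end
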